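(* Let $(S,d)$ be a bounded metric space with more than one point that is complete and uniformly perfect, and let $\{\mathbf{X}^n\}_{n\in\mathbb{N}_0}$ be a sequence of covers of $S$ by non-empty subsets with $\mathbf{X}^0=\{S\}$ such that the tile graph $\Gamma=\Gamma(\{\mathbf{X}^n\})$ is Gromov hyperbolic. Let $d_\infty$ be a visual metric (in the sense of Gromov hyperbolic spaces) on $\partial_\infty\Gamma$, and for $r\in\mathbb{N}_0$ let $\{\mathbf{V}^n_r\}_{n\in\mathbb{N}_0}$ be the sequence of covers of $S$ given by the neighborhood clusters of radius $r$, that is, $\mathbf{V}^n_r=\{V_r(X):X\in\mathbf{X}^n\}$. Then there exists $r_0\in\mathbb{N}_0$ such that for every $r\in\mathbb{N}_0$ with $r\ge r_0$ the following statements are true for the map $\Phi\colon(S,d)\to(\partial_\infty\Gamma,d_\infty)$ that sends $x\in S$ to the class of a natural geodesic of $x$: (i) If $\Phi$ is a quasisymmetry, then $\{\mathbf{V}^n_r\}$ is a quasi-visual approximation of width $w=1$ for $(S,d)$. (ii) If $\Phi$ is a snowflake equivalence, then $\{\mathbf{V}^n_r\}$ is a visual approximation of width $w=1$ for $(S,d)$ (with some visual parameter).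
   Context: $\mathbb{N}_0=\{0,1,2,\dots\}$, $\mathbb{N}=\{1,2,\dots\}$. $(S,d)$ is uniformly perfect if there is $\lambda\in(0,1)$ such that $B(x,r)\setminus\overline{B(x,\lambda r)}\neq\emptyset$ for all $x\in S$, $0<r\le \operatorname{diam}(S)$. A bijection $\varphi\colon (S,d)\to (T,\varrho)$ is a quasisymmetry if there is a homeomorphism $\eta\colon[0,\infty)\to[0,\infty)$ with $\frac{\varrho(\varphi(x),\varphi(y))}{\varrho(\varphi(x),\varphi(z))}\le\eta\left(\frac{d(x,y)}{d(x,z)}\right)$ for all $x,y,z\in S$, $x\ne z$; it is a snowflake equivalence if there are $\alpha>0$, $C\ge1$ with $\frac1Cd(x,y)^\alpha\le\varrho(\varphi(x),\varphi(y))\le Cd(x,y)^\alpha$ for all $x,y\in S$. Covers, tiles: a cover of $S$ is a collection (possibly infinite) of subsets of $S$ with union $S$. Let $\{\mathbf{W}^n\}_{n\in\mathbb{N}_0}$ be a sequence of covers of $S$. For $X\in\mathbf{W}^n$ and $w\in\mathbb{N}_0$, $U_w(X)$ is the union of all $Y\in\mathbf{W}^n$ such that there are $X_0=X,\dots,X_k=Y$ in $\mathbf{W}^n$ with $k\le w$ and $X_j\cap X_{j+1}\neq\emptyset$ for all $j<k$. Write $\operatorname{dist}(X,Y)=\inf\{d(x,y):x\in X,\,y\in Y\}$. $\{\mathbf{W}^n\}$ is a visual approximation of width $w$ with visual parameter $\Lambda>1$ for the bounded metric space $(S,d)$ if $\mathbf{W}^0=\{S\}$ and there is $C\ge1$ such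 that for all $n$ and $X,Y\in\mathbf{W}^n$: $\frac1C\Lambda^{-n}\le\operatorname{diam}(X)\le C\Lambda^{-n}$; and $\operatorname{dist}(X,Y)\ge\frac1C\Lambda^{-n}$ whenever $U_w(X)\cap U_w(Y)=\emptyset$. $\{\mathbf{W}^n\}$ is a quasi-visual approximation of width $w$ for $(S,d)$ (bounded, more than one point) if $\mathbf{W}^0=\{S\}$ and there are $C\ge1$, $k_0\in\mathbb{N}$, $\lambda\in(0,1)$ such that for all $n\in\mathbb{N}_0$: (1) $\frac1C\operatorname{diam}(Y)\le\operatorname{diam}(X)\le C\operatorname{diam}(Y)$ for $X,Y\in\mathbf{W}^n$ with $X\cap Y\neq\emptyset$; (2) $\operatorname{dist}(X,Y)\ge\frac1C\operatorname{diam}(X)$ for $X,Y\in\mathbf{W}^n$ with $U_w(X)\cap U_w(Y)=\emptyset$; (3) $\frac1C\operatorname{diam}(Y)\le\operatorname{diam}(X)\le C\operatorname{diam}(Y)$ for $X\in\mathbf{W}^n$, $Y\in\mathbf{W}^{n+1}$ with $X\cap Y\ne\emptyset$; (4) $\operatorname{diam}(Y)\le\lambda\operatorname{diam}(X)$ for $X\in\mathbf{W}^n$, $Y\in\mathbf{W}^{n+k_0}$ with $X\cap Y\ne\emptyset$. Tile graph: $\mathbf{X}=\bigsqcup_{n}\mathbf{X}^n$ is the formal disjoint union (the same subset on two different levels gives two different elements), $|X|=n$ is the level of $X\in\mathbf{X}^n$. The tile graph $\Gamma$ has vertex set $\mathbf{X}$; distinct $X,Y$ are joined by an edge iff $X\cap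 Y\neq\emptyset$ and $\big||X|-|Y|\big|\le1$. $|X-Y|$ is the combinatorial (path) distance in $\Gamma$, $(X\cdot Y)=\frac12(|X|+|Y|-|X-Y|)$ is the Gromov product, and $\Gamma$ is Gromov hyperbolic if there is $C\ge0$ with $(X\cdot Y)\ge\min\{(X\cdot Z),(Z\cdot Y)\}-C$ for all $X,Y,Z\in\mathbf{X}$. For $r\in\mathbb{N}_0$ and $X\in\mathbf{X}$, the neighborhood cluster of radius $r$ is $V_r(X)=\bigcup\{Y\in\mathbf{X}:|X-Y|\le r\}\subset S$ (the $Y$'s may have different levels). Boundary: a sequence $\{X_i\}$ in $\mathbf{X}$ converges at infinity if $\lim_{i,j\to\infty}(X_i\cdot X_j)=\infty$; two such sequences are equivalent if $\lim_{i\to\infty}(X_i\cdot Y_i)=\infty$. $\partial_\infty\Gamma$ is the set of equivalence classes $[\{X_i\}]$. Put $(X^\infty\cdot Y^\infty)=\sup\{\liminf_{i\to\infty}(X_i\cdot Y_i):\{X_i\}\in X^\infty,\{Y_i\}\in Y^\infty\}\in[0,\infty]$. A metric $d_\infty$ on $\partial_\infty\Gamma$ is visual (in the sense of Gromov hyperbolic spaces) if there are $\Lambda_\infty>1$, $C\ge1$ with $\frac1C\Lambda_\infty^{-(X^\infty\cdot Y^\infty)}\le d_\infty(X^\infty,Y^\infty)\le C\Lambda_\infty^{-(X^\infty\cdot Y^\infty)}$ for all $X^\infty,Y^\infty\in\partial_\infty\Gamma$ (with $\Lambda_\infty^{-\infty}=0$). A natural geodesic of $x\in S$ is a sequence $\{X^n\}_{n\in\mathbb{N}_0}$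 with $x\in X^n\in\mathbf{X}^n$ for all $n$; such sequences converge at infinity and any two natural geodesics of the same point are equivalent, so $\Phi(x)=[\{X^n\}]$ is well defined. *)

theory Defs
  imports "HOL-Analysis.Analysis"
begin

text \<open>A metric space is a carrier with a distance function, as in the locale \<^locale>\<open>Metric_space\<close>:
  the boundary of the tile graph carries a metric that is only a variable of the theorem. The next two
  definitions are \<^const>\<open>diameter\<close> and \<^const>\<open>setdist\<close> for an explicit distance function, with the same
  convention for empty sets (which do not occur among the tiles).\<close>

definition mdiam :: "('a \<Rightarrow> 'a \<Rightarrow> real) \<Rightarrow> 'a set \<Rightarrow> real" where
  "mdiam d A = (if A = {} then 0 else SUP (x, y)\<in>A \<times> A. d x y)"

definition msetdist :: "('a \<Rightarrow> 'a \<Rightarrow> real) \<Rightarrow> 'a set \<Rightarrow> 'a set \<Rightarrow> real" where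
  "msetdist d A B = (if A = {} \<or> B = {} then 0 else Inf {d x y | x y. x \<in> A \<and> y \<in> B})"

definition uniformly_perfect :: "'a set \<Rightarrow> ('a \<Rightarrow> 'a \<Rightarrow> real) \<Rightarrow> bool" where
  "uniformly_perfect S d \<longleftrightarrow>
     (\<exists>l. 0 < l \<and> l < 1 \<and>
        (\<forall>x\<in>S. \<forall>r. 0 < r \<and> r \<le> mdiam d S \<longrightarrow>
           Metric_space.mball S d x r
             - (Metric_space.mtopology S d closure_of Metric_space.mball S d x (l * r)) \<noteq> {}))"

definition quasisymmetry ::
  "'a set \<Rightarrow> ('a \<Rightarrow> 'a \<Rightarrow> real) \<Rightarrow> 'b set \<Rightarrow> ('b \<Rightarrow> 'b \<Rightarrow> real) \<Rightarrow> ('a \<Rightarrow> 'b) \<Rightarrow> bool" where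
  "quasisymmetry S d T \<rho> \<phi> \<longleftrightarrow>
     bij_betw \<phi> S T \<and>
     (\<exists>\<eta> \<eta>' :: real \<Rightarrow> real. homeomorphism {0..} {0..} \<eta> \<eta>' \<and>
        (\<forall>x\<in>S. \<forall>y\<in>S. \<forall>z\<in>S. x \<noteq> z \<longrightarrow>
           \<rho> (\<phi> x) (\<phi> y) / \<rho> (\<phi> x) (\<phi> z) \<le> \<eta> (d x y / d x z)))"

definition snowflake_equivalence ::
  "'a set \<Rightarrow> ('a \<Rightarrow> 'a \<Rightarrow> real) \<Rightarrow> 'b set \<Rightarrow> ('b \<Rightarrow> 'b \<Rightarrow> real) \<Rightarrow> ('a \<Rightarrow> 'b) \<Rightarrow> bool" where
  "snowflake_equivalence S d T \<rho> \<phi> \<longleftrightarrow>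
     bij_betw \<phi> S T \<and>
     (\<exists>\<alpha> C :: real. \<alpha> > 0 \<and> C \<ge> 1 \<and>
        (\<forall>x\<in>S. \<forall>y\<in>S.
           1 / C * d x y powr \<alpha> \<le> \<rho> (\<phi> x) (\<phi> y) \<and>
           \<rho> (\<phi> x) (\<phi> y) \<le> C * d x y powr \<alpha>))"

definition cover_seq :: "'a set \<Rightarrow> (nat \<Rightarrow> 'a set set) \<Rightarrow> bool" where
  "cover_seq S W \<longleftrightarrow> (\<forall>n. \<Union>(W n) = S)"

text \<open>\<open>tile_nbhd W w X\<close> is the set \<open>U\<^sub>w(X)\<close> with respect to the single cover \<open>W\<close>.\<close>

definition tile_nbhd :: "'a set set \<Rightarrow> nat \<Rightarrow> 'a set \<Rightarrow> 'a set" where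
  "tile_nbhd W w X =
     \<Union>{Y \<in> W. \<exists>k\<le>w. \<exists>Z :: nat \<Rightarrow> 'a set. Z 0 = X \<and> Z k = Y \<and> (\<forall>j\<le>k. Z j \<in> W) \<and>
                 (\<forall>j<k. Z j \<inter> Z (Suc j) \<noteq> {})}"

definition visual_approximation ::
  "'a set \<Rightarrow> ('a \<Rightarrow> 'a \<Rightarrow> real) \<Rightarrow> nat \<Rightarrow> real \<Rightarrow> (nat \<Rightarrow> 'a set set) \<Rightarrow> bool" where
  "visual_approximation S d w \<Lambda> W \<longleftrightarrow>
     Metric_space S d \<and> Metric_space.mbounded S d S \<and> \<Lambda> > 1 \<and>
     cover_seq S W \<and> W 0 = {S} \<and>
     (\<exists>C\<ge>1. \<forall>n.
        (\<forall>X\<in>W n. 1 / C * \<Lambda> powr (- real n) \<le> mdiam d X \<and> mdiam d X \<le> C * \<Lambda> powr (- real n)) \<and>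
        (\<forall>X\<in>W n. \<forall>Y\<in>W n. tile_nbhd (W n) w X \<inter> tile_nbhd (W n) w Y = {} \<longrightarrow>
           msetdist d X Y \<ge> 1 / C * \<Lambda> powr (- real n)))"

definition quasi_visual_approximation ::
  "'a set \<Rightarrow> ('a \<Rightarrow> 'a \<Rightarrow> real) \<Rightarrow> nat \<Rightarrow> (nat \<Rightarrow> 'a set set) \<Rightarrow> bool" where
  "quasi_visual_approximation S d w W \<longleftrightarrow>
     Metric_space S d \<and> Metric_space.mbounded S d S \<and> (\<exists>x\<in>S. \<exists>y\<in>S. x \<noteq> y) \<and>
     cover_seq S W \<and> W 0 = {S} \<and>
     (\<exists>(C::real) (k0::nat) (l::real). C \<ge> 1 \<and> k0 \<ge> 1 \<and> 0 < l \<and> l < 1 \<and> (\<forall>n.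
        (\<forall>X\<in>W n. \<forall>Y\<in>W n. X \<inter> Y \<noteq> {} \<longrightarrow>
           1 / C * mdiam d Y \<le> mdiam d X \<and> mdiam d X \<le> C * mdiam d Y) \<and>
        (\<forall>X\<in>W n. \<forall>Y\<in>W n. tile_nbhd (W n) w X \<inter> tile_nbhd (W n) w Y = {} \<longrightarrow>
           msetdist d X Y \<ge> 1 / C * mdiam d X) \<and>
        (\<forall>X\<in>W n. \<forall>Y\<in>W (n + 1). X \<inter> Y \<noteq> {} \<longrightarrow>
           1 / C * mdiam d Y \<le> mdiam d X \<and> mdiam d X \<le> C * mdiam d Y) \<and>
        (\<forall>X\<in>W n. \<forall>Y\<in>W (n + k0). X \<inter> Y \<noteq> {} \<longrightarrow> mdiam d Y \<le> l * mdiam d X)))"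

text \<open>A vertex is a pair of a level and a tile of that level, so the same set on two levels gives two vertices.\<close>

type_synonym 'a tile = "nat \<times> 'a set"

definition tiles :: "(nat \<Rightarrow> 'a set set) \<Rightarrow> 'a tile set" where
  "tiles X = (SIGMA n:UNIV. X n)"

definition tile_edges :: "(nat \<Rightarrow> 'a set set) \<Rightarrow> ('a tile \<times> 'a tile) set" where
  "tile_edges X = {(u, v). u \<in> tiles X \<and> v \<in> tiles X \<and> u \<noteq> v \<and> snd u \<inter> snd v \<noteq> {} \<and>
                           \<bar>int (fst u) - int (fst v)\<bar> \<le> 1}"

text \<open>The path distance; it is meaningful because the tile graph of a sequence of covers by non-empty sets
  that starts with a single tile is connected.\<close>

definition tile_dist :: "(nat \<Rightarrow> 'a set set) \<Rightarrow> 'a tile \<Rightarrow> 'a tile \<Rightarrow> nat" where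
  "tile_dist X u v = (LEAST k. (u, v) \<in> tile_edges X ^^ k)"

definition gromov_prod :: "(nat \<Rightarrow> 'a set set) \<Rightarrow> 'a tile \<Rightarrow> 'a tile \<Rightarrow> real" where
  "gromov_prod X u v = (real (fst u) + real (fst v) - real (tile_dist X u v)) / 2"

definition gromov_hyperbolic :: "(nat \<Rightarrow> 'a set set) \<Rightarrow> bool" where
  "gromov_hyperbolic X \<longleftrightarrow>
     (\<exists>C\<ge>0. \<forall>u\<in>tiles X. \<forall>v\<in>tiles X. \<forall>z\<in>tiles X.
        gromov_prod X u v \<ge> min (gromov_prod X u z) (gromov_prod X z v) - C)"

definition cluster :: "(nat \<Rightarrow> 'a set set) \<Rightarrow> nat \<Rightarrow> 'a tile \<Rightarrow> 'a set" where
  "cluster X r u = \<Union>{snd v | v. v \<in> tiles X \<and> tile_dist X u v \<le> r}"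

definition cluster_covers :: "(nat \<Rightarrow> 'a set set) \<Rightarrow> nat \<Rightarrow> nat \<Rightarrow> 'a set set" where
  "cluster_covers X r n = {cluster X r (n, A) | A. A \<in> X n}"

definition converges_at_infinity :: "(nat \<Rightarrow> 'a set set) \<Rightarrow> (nat \<Rightarrow> 'a tile) \<Rightarrow> bool" where
  "converges_at_infinity X s \<longleftrightarrow>
     (\<forall>i. s i \<in> tiles X) \<and>
     filterlim (\<lambda>(i, j). gromov_prod X (s i) (s j)) at_top (sequentially \<times>\<^sub>F sequentially)"

definition boundary_rel :: "(nat \<Rightarrow> 'a set set) \<Rightarrow> ((nat \<Rightarrow> 'a tile) \<times> (nat \<Rightarrow> 'a tile)) set" where
  "boundary_rel X = {(s, t). converges_at_infinity X s \<and> converges_at_infinity X t \<and>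
                             filterlim (\<lambda>i. gromov_prod X (s i) (t i)) at_top sequentially}"

definition boundary :: "(nat \<Rightarrow> 'a set set) \<Rightarrow> (nat \<Rightarrow> 'a tile) set set" where
  "boundary X = {s. converges_at_infinity X s} // boundary_rel X"

definition boundary_prod ::
  "(nat \<Rightarrow> 'a set set) \<Rightarrow> (nat \<Rightarrow> 'a tile) set \<Rightarrow> (nat \<Rightarrow> 'a tile) set \<Rightarrow> ereal" where
  "boundary_prod X \<xi> \<zeta> =
     (SUP (s, t)\<in>\<xi> \<times> \<zeta>. liminf (\<lambda>i. ereal (gromov_prod X (s i) (t i))))"

text \<open>\<open>\<Lambda>\<^sup>-\<^sup>t\<close> for \<open>t \<in> [0, \<infinity>]\<close>.\<close>

definition neg_powr :: "real \<Rightarrow> ereal \<Rightarrow> real" where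
  "neg_powr \<Lambda> t = (if t = \<infinity> then 0 else \<Lambda> powr (- real_of_ereal t))"

definition visual_metric ::
  "(nat \<Rightarrow> 'a set set) \<Rightarrow> ((nat \<Rightarrow> 'a tile) set \<Rightarrow> (nat \<Rightarrow> 'a tile) set \<Rightarrow> real) \<Rightarrow> bool" where
  "visual_metric X \<rho> \<longleftrightarrow>
     Metric_space (boundary X) \<rho> \<and>
     (\<exists>\<Lambda> C. \<Lambda> > 1 \<and> C \<ge> 1 \<and>
        (\<forall>\<xi>\<in>boundary X. \<forall>\<zeta>\<in>boundary X.
           1 / C * neg_powr \<Lambda> (boundary_prod X \<xi> \<zeta>) \<le> \<rho> \<xi> \<zeta> \<and>
           \<rho> \<xi> \<zeta> \<le> C * neg_powr \<Lambda> (boundary_prod X \<xi> \<zeta>)))"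

definition natural_geodesic :: "(nat \<Rightarrow> 'a set set) \<Rightarrow> 'a \<Rightarrow> (nat \<Rightarrow> 'a tile) \<Rightarrow> bool" where
  "natural_geodesic X x g \<longleftrightarrow> (\<forall>n. g n \<in> tiles X \<and> fst (g n) = n \<and> x \<in> snd (g n))"

text \<open>The class of a natural geodesic of \<open>x\<close>; lemma \<open>boundary_map_eq\<close> below shows that the choice does not matter.\<close>

definition boundary_map :: "(nat \<Rightarrow> 'a set set) \<Rightarrow> 'a \<Rightarrow> (nat \<Rightarrow> 'a tile) set" where
  "boundary_map X x = boundary_rel X `` {SOME g. natural_geodesic X x g}"

lemma tile_dist_le: "(u, v) \<in> tile_edges X ^^ k \<Longrightarrow> tile_dist X u v \<le> k"
  unfolding tile_dist_def by (rule Least_le)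

lemma natural_geodesic_dist:
  assumes g: "natural_geodesic X x g" and h: "natural_geodesic X x h"
  shows "tile_dist X (g n) (h (n + k)) \<le> k + 1" "tile_dist X (g (n + k)) (h n) \<le> k + 1"
    "tile_dist X (g n) (g (n + k)) \<le> k" "tile_dist X (g (n + k)) (g n) \<le> k"
proof -
  have up: "(f n, f (n + k)) \<in> tile_edges X ^^ k" "(f (n + k), f n) \<in> tile_edges X ^^ k"
    if f: "natural_geodesic X x f" for f
  proof (induction k)
    case 0
    { case 1 show ?case by simp next case 2 show ?case by simp }
  next
    case (Suc k)
    have e: "(f (n + k), f (n + Suc k)) \<in> tile_edges X" "(f (n + Suc k), f (n + k)) \<in> tile_edges X"
      using f unfolding natural_geodesic_def tile_edges_def
      by (auto simp: prod_eq_iff dest: spec[of _ "n + k"] spec[of _ "Suc (n + k)"])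
    { case 1 show ?case using Suc e by auto
    next case 2 show ?case using Suc(2) e(2) by (rule relpow_Suc_I2[rotated]) }
  qed
  have across: "(g m, h m) \<in> tile_edges X \<or> g m = h m" for m
    using g h unfolding natural_geodesic_def tile_edges_def
    by (auto dest: spec[of _ m])
  show "tile_dist X (g n) (g (n + k)) \<le> k" "tile_dist X (g (n + k)) (g n) \<le> k"
    using up[OF g] by (auto intro: tile_dist_le)
  show "tile_dist X (g n) (h (n + k)) \<le> k + 1"
    using across[of "n + k"] up[OF g] tile_dist_le
    by (metis Suc_eq_plus1 relpow_Suc_I le_SucI)
  show "tile_dist X (g (n + k)) (h n) \<le> k + 1"
    using across[of "n"] up[OF g] tile_dist_le
    by (metis Suc_eq_plus1 relpow_Suc_I le_SucI)
qed

lemma natural_geodesic_prod: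
  assumes g: "natural_geodesic X x g" and h: "natural_geodesic X x h"
  shows "gromov_prod X (g i) (h j) \<ge> min (real i) (real j) - 1 / 2"
proof -
  have "tile_dist X (g i) (h j) \<le> max i j - min i j + 1"
    using natural_geodesic_dist(1)[OF g h, of i "j - i"] natural_geodesic_dist(2)[OF g h, of j "i - j"]
    by (cases "i \<le> j") (auto simp: max_def min_def)
  then have "real (tile_dist X (g i) (h j)) \<le> max (real i) (real j) - min (real i) (real j) + 1"
    by (auto simp: max_def min_def split: if_splits)
  moreover have "fst (g i) = i" "fst (h j) = j"
    using g h by (auto simp: natural_geodesic_def)
  ultimately show ?thesis
    unfolding gromov_prod_def by (auto simp: max_def min_def field_simps split: if_splits)
qed

lemma natural_geodesic_converges:
  assumes g: "natural_geodesic X x g"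
  shows "converges_at_infinity X g"
proof -
  have "\<forall>\<^sub>F p in sequentially \<times>\<^sub>F sequentially. Z \<le> (case p of (i, j) \<Rightarrow> gromov_prod X (g i) (g j))" for Z
  proof -
    obtain N :: nat where N: "Z + 1 \<le> real N" using real_arch_simple by blast
    have "\<forall>\<^sub>F p in sequentially \<times>\<^sub>F sequentially. N \<le> fst p \<and> N \<le> snd p"
      by (rule eventually_prodI[OF eventually_ge_at_top[of N] eventually_ge_at_top[of N],
            THEN eventually_mono]) auto
    then show ?thesis
    proof eventually_elim
      case (elim p)
      then show ?case
        using natural_geodesic_prod[OF g g, of "fst p" "snd p"] N by (auto simp: case_prod_beta min_def split: if_splits)
    qed
  qed
  then show ?thesis
    using g by (auto simp: converges_at_infinity_def natural_geodesic_def filterlim_at_top)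
qed

lemma natural_geodesic_equivalent:
  assumes g: "natural_geodesic X x g" and h: "natural_geodesic X x h"
  shows "(g, h) \<in> boundary_rel X"
proof -
  have "filterlim (\<lambda>i. - (1 / 2) + real i) at_top sequentially"
    by (rule filterlim_tendsto_add_at_top[OF tendsto_const filterlim_real_sequentially])
  then have "filterlim (\<lambda>i. gromov_prod X (g i) (h i)) at_top sequentially"
    by (rule filterlim_at_top_mono) (use natural_geodesic_prod[OF g h, of i i for i] in auto)
  then show ?thesis
    using natural_geodesic_converges g h by (auto simp: boundary_rel_def)
qed

lemma tile_dist_commute: "tile_dist X u v = tile_dist X v u"
proof -
  have sym: "(a, b) \<in> tile_edges X \<Longrightarrow> (b, a) \<in> tile_edges X" for a b
    by (auto simp: tile_edges_def abs_minus_commute)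
  have "(a, b) \<in> tile_edges X ^^ k \<Longrightarrow> (b, a) \<in> tile_edges X ^^ k" for a b k
  proof (induction k arbitrary: b)
    case (Suc k)
    then obtain c where "(a, c) \<in> tile_edges X ^^ k" "(c, b) \<in> tile_edges X"
      by (rule_tac relpow_Suc_E)
    then show ?case using Suc.IH sym by (blast intro: relpow_Suc_I2)
  qed simp
  then have "(u, v) \<in> tile_edges X ^^ k \<longleftrightarrow> (v, u) \<in> tile_edges X ^^ k" for k
    by blast
  then show ?thesis by (simp add: tile_dist_def)
qed

lemma gromov_prod_commute: "gromov_prod X u v = gromov_prod X v u"
  by (simp add: gromov_prod_def tile_dist_commute[of X u v])

lemma equiv_boundary_rel:
  assumes "gromov_hyperbolic X"
  shows "equiv {s. converges_at_infinity X s} (boundary_rel X)"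
proof (rule equivI)
  show "boundary_rel X \<subseteq> {s. converges_at_infinity X s} \<times> {s. converges_at_infinity X s}"
    by (auto simp: boundary_rel_def)
  show "refl_on {s. converges_at_infinity X s} (boundary_rel X)"
  proof (rule refl_onI)
    fix s assume "s \<in> {s. converges_at_infinity X s}"
    then have s: "converges_at_infinity X s" by simp
    have "filterlim (\<lambda>i::nat. (i, i)) (sequentially \<times>\<^sub>F sequentially) sequentially"
      by (intro filterlim_Pair filterlim_ident)
    from filterlim_compose[OF conjunct2[OF s[unfolded converges_at_infinity_def]] this]
    show "(s, s) \<in> boundary_rel X" using s by (simp add: boundary_rel_def)
  qed
  show "sym (boundary_rel X)"
    by (auto simp: sym_def boundary_rel_def gromov_prod_commute)
  show "trans (boundary_rel X)"
  proof (rule transI)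
    fix s t u assume st: "(s, t) \<in> boundary_rel X" and tu: "(t, u) \<in> boundary_rel X"
    obtain C where C: "\<And>a b c. a \<in> tiles X \<Longrightarrow> b \<in> tiles X \<Longrightarrow> c \<in> tiles X \<Longrightarrow>
        gromov_prod X a b \<ge> min (gromov_prod X a c) (gromov_prod X c b) - C"
      using assms by (auto simp: gromov_hyperbolic_def)
    have mem: "s i \<in> tiles X" "t i \<in> tiles X" "u i \<in> tiles X" for i
      using st tu by (auto simp: boundary_rel_def converges_at_infinity_def)
    have "\<forall>\<^sub>F i in sequentially. Z \<le> gromov_prod X (s i) (u i)" for Z
    proof -
      have "\<forall>\<^sub>F i in sequentially. Z + C \<le> gromov_prod X (s i) (t i)"
        "\<forall>\<^sub>F i in sequentially. Z + C \<le> gromov_prod X (t i) (u i)"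
        using st tu by (auto simp: boundary_rel_def filterlim_at_top)
      then show ?thesis
      proof eventually_elim
        case (elim i)
        then show ?case using C[OF mem(1)[of i] mem(3)[of i] mem(2)[of i]] by linarith
      qed
    qed
    then show "(s, u) \<in> boundary_rel X"
      using st tu by (auto simp: boundary_rel_def filterlim_at_top)
  qed
qed

lemma boundary_map_eq:
  assumes "gromov_hyperbolic X" "natural_geodesic X x g"
  shows "boundary_map X x = boundary_rel X `` {g}" "boundary_map X x \<in> boundary X"
proof -
  show "boundary_map X x = boundary_rel X `` {g}"
    unfolding boundary_map_def
    by (rule equiv_class_eq[OF equiv_boundary_rel[OF assms(1)]])
      (rule natural_geodesic_equivalent[OF someI[of "natural_geodesic X x", OF assms(2)] assms(2)])
  then show "boundary_map X x \<in> boundary X"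
    using natural_geodesic_converges[OF assms(2)] by (auto simp: boundary_def intro: quotientI)
qed

end

theory Submission
  imports Defs
begin

text \<open>
  Pull the visual metric back to \<open>S\<close>: \<open>\<rho> x y = d_inf (\<Phi> x) (\<Phi> y)\<close> with \<open>\<Phi> = boundary_map X\<close>. Up to a
  constant factor, \<open>\<rho> x y\<close> is \<open>L\<close> to the power minus the boundary product of \<open>\<Phi> x\<close> and \<open>\<Phi> y\<close>, and by
  hyperbolicity this product is tied to Gromov products of tiles. If tiles \<open>u \<ni> x\<close> and \<open>v \<ni> y\<close> have a
  large Gromov product, then so have \<open>\<Phi> x\<close> and \<open>\<Phi> y\<close> (\<open>boundary_prod_ge\<close>); conversely, if the boundary
  product exceeds \<open>n\<close>, then all tiles of level \<open>n\<close> that contain \<open>x\<close> and \<open>y\<close> have graph distance at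
  most \<open>1 + 8\<delta>\<close> (\<open>gromov_prod_ge\<close>). The first fact bounds the \<open>\<rho>\<close>-diameter of a cluster of level \<open>n\<close>
  by a multiple of \<open>L\<^sup>-\<^sup>n\<close>. The second one says that for \<open>r \<ge> 1 + 8\<delta>\<close> a cluster of level \<open>n\<close> contains a
  \<open>\<rho>\<close>-ball of radius comparable to \<open>L\<^sup>-\<^sup>n\<close> around each point of its central tile. This forces clusters
  with disjoint neighborhoods to be \<open>L\<^sup>-\<^sup>n\<close>-apart and, if \<open>(S, \<rho>)\<close> is uniformly perfect, also bounds the
  diameter of a cluster from below. So the clusters form a visual approximation of width 1 for \<open>(S, \<rho>)\<close>
  (\<open>visual_approximation_cluster_covers\<close>).

  It remains to pass from \<open>\<rho>\<close> to \<open>d\<close>. A quasisymmetry and a snowflake equivalence have in common that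
  ratios of distances from a common point are controlled in both metrics (\<open>qs_comparable\<close>). This symmetric
  relation transports uniform perfectness from \<open>d\<close> to \<open>\<rho>\<close> (\<open>has_annuli_qs_comparable\<close>) and turns a visual
  approximation for \<open>\<rho>\<close> into a quasi-visual one for \<open>d\<close> (\<open>visual_approximation_qs_comparable\<close>). If \<open>\<rho>\<close> is
  comparable to \<open>d\<^sup>a\<close>, then scale \<open>L\<^sup>-\<^sup>n\<close> for \<open>\<rho>\<close> is scale \<open>L\<^sup>-\<^sup>n\<^sup>/\<^sup>a\<close> for \<open>d\<close>, and the approximation stays
  visual with parameter \<open>L powr (1 / a)\<close> (\<open>visual_approximation_snowflake\<close>).
\<close>

section \<open>Diameters and distances of sets\<close>

lemma mdiam_le:
  assumes "A \<noteq> {}" "\<And>x y. x \<in> A \<Longrightarrow> y \<in> A \<Longrightarrow> d x y \<le> B"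
  shows "mdiam d A \<le> B"
  using assms by (auto simp: mdiam_def intro!: cSUP_least)

lemma mdiam_pos_imp_nonempty: "mdiam d A > 0 \<Longrightarrow> A \<noteq> {}"
  by (auto simp: mdiam_def)

lemma msetdist_ge:
  assumes "A \<noteq> {}" "B \<noteq> {}" "\<And>x y. x \<in> A \<Longrightarrow> y \<in> B \<Longrightarrow> t \<le> d x y"
  shows "t \<le> msetdist d A B"
  using assms unfolding msetdist_def by (auto intro!: cInf_greatest)

context Metric_space
begin

lemma le_mdiam:
  assumes bd: "mbounded M" and "A \<subseteq> M" "x \<in> A" "y \<in> A"
  shows "d x y \<le> mdiam d A"
proof -
  obtain B where B: "\<And>x y. x \<in> M \<Longrightarrow> y \<in> M \<Longrightarrow> d x y \<le> B"
    using bd unfolding mbounded_alt by blast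
  have "bdd_above ((\<lambda>(x, y). d x y) ` (A \<times> A))"
    by (rule bdd_aboveI2[where M = B]) (use B assms(2) in auto)
  then have "(case (x, y) of (x, y) \<Rightarrow> d x y) \<le> (SUP (x, y)\<in>A \<times> A. d x y)"
    using assms(3,4) by (intro cSUP_upper) auto
  then show ?thesis using assms(3) by (auto simp: mdiam_def)
qed

lemma mdiam_le_twice:
  assumes "A \<subseteq> M" "p \<in> A" "\<And>x. x \<in> A \<Longrightarrow> d p x \<le> B"
  shows "mdiam d A \<le> 2 * B"
proof (rule mdiam_le)
  fix x y assume xy: "x \<in> A" "y \<in> A"
  have "d x y \<le> d x p + d p y" using xy assms by (intro triangle) auto
  also have "\<dots> \<le> 2 * B" using assms(3)[OF xy(1)] assms(3)[OF xy(2)] by (simp add: commute)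
  finally show "d x y \<le> 2 * B" .
qed (use assms in auto)

lemma mdiam_pos:
  assumes "mbounded M" "A \<subseteq> M" "x \<in> A" "y \<in> A" "x \<noteq> y"
  shows "0 < mdiam d A"
proof -
  have "0 < d x y" using assms by (meson mdist_pos_less subsetD)
  also have "\<dots> \<le> mdiam d A" using assms by (intro le_mdiam)
  finally show ?thesis .
qed

lemma far_point_exists:
  assumes "A \<subseteq> M" "p \<in> A" "mdiam d A > 0"
  obtains z where "z \<in> A" "mdiam d A \<le> 4 * d p z"
proof (rule ccontr)
  assume "\<not> thesis"
  then have "\<And>z. z \<in> A \<Longrightarrow> d p z \<le> mdiam d A / 4"
    using that by fastforce
  then have "mdiam d A \<le> 2 * (mdiam d A / 4)"
    using assms by (intro mdiam_le_twice)
  then show False using assms(3) by simp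
qed

lemma msetdist_le:
  assumes "x \<in> A" "y \<in> B"
  shows "msetdist d A B \<le> d x y"
proof -
  have "bdd_below {d x y | x y. x \<in> A \<and> y \<in> B}"
    by (rule bdd_belowI[where m = 0]) auto
  then show ?thesis
    using assms unfolding msetdist_def by (auto intro!: cInf_lower)
qed

end

section \<open>Quasisymmetrically comparable metrics\<close>

text \<open>What remains of a quasisymmetry when its control function \<open>\<eta>\<close> is known only to be bounded on bounded
  sets and to tend to \<open>0\<close> at \<open>0\<close>. The inequalities are kept free of quotients, so \<open>x = z\<close> is permitted: both
  premises then force \<open>y = x\<close>.\<close>

definition qs_comparable :: "'a set \<Rightarrow> ('a \<Rightarrow> 'a \<Rightarrow> real) \<Rightarrow> ('a \<Rightarrow> 'a \<Rightarrow> real) \<Rightarrow> bool" where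
  "qs_comparable S d \<rho> \<longleftrightarrow>
     (\<forall>K>0. \<exists>M>0. \<forall>x\<in>S. \<forall>y\<in>S. \<forall>z\<in>S. d x y \<le> K * d x z \<longrightarrow> \<rho> x y \<le> M * \<rho> x z) \<and>
     (\<forall>e>0. \<exists>e'>0. \<forall>x\<in>S. \<forall>y\<in>S. \<forall>z\<in>S. d x y \<le> e' * d x z \<longrightarrow> \<rho> x y \<le> e * \<rho> x z)"

text \<open>Exchanging \<open>y\<close> and \<open>z\<close> in the contrapositive turns the control of small ratios in one direction into
  the control of large ratios in the other, and vice versa. The factor 2 makes strict inequalities out of
  the weak ones.\<close>

lemma qs_comparable_sym:
  assumes d: "Metric_space S d" and r: "Metric_space S \<rho>" and qs: "qs_comparable S d \<rho>"
  shows "qs_comparable S \<rho> d"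
proof -
  interpret d: Metric_space S d by fact
  interpret r: Metric_space S \<rho> by fact
  have big: "\<exists>M>0. \<forall>x\<in>S. \<forall>y\<in>S. \<forall>z\<in>S. \<rho> x y \<le> K * \<rho> x z \<longrightarrow> d x y \<le> M * d x z" if K: "K > 0" for K
  proof -
    have "1 / (2 * K) > 0" using K by simp
    then obtain e where e: "e > 0" "\<And>x y z. x \<in> S \<Longrightarrow> y \<in> S \<Longrightarrow> z \<in> S \<Longrightarrow>
        d x y \<le> e * d x z \<Longrightarrow> \<rho> x y \<le> 1 / (2 * K) * \<rho> x z"
      using qs unfolding qs_comparable_def by meson
    have "d x y \<le> 1 / e * d x z"
      if S: "x \<in> S" "y \<in> S" "z \<in> S" and le: "\<rho> x y \<le> K * \<rho> x z" for x y z
    proof (rule ccontr)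
      assume "\<not> d x y \<le> 1 / e * d x z"
      then have lt: "d x z < e * d x y" using e(1) by (simp add: field_simps)
      then have "\<rho> x z \<le> 1 / (2 * K) * \<rho> x y" using e(2)[OF S(1,3,2)] by simp
      then have "\<rho> x y \<le> 1 / 2 * \<rho> x y"
        using le K mult_left_mono[of "\<rho> x z" "1 / (2 * K) * \<rho> x y" K] by simp
      then have "x = y" using S r.nonneg[of x y] r.zero[of x y] by simp
      then have "d x y = 0" using S by simp
      then show False using lt d.nonneg[of x z] by simp
    qed
    then show ?thesis using e(1) by (intro exI[of _ "1 / e"]) auto
  qed
  have small: "\<exists>e'>0. \<forall>x\<in>S. \<forall>y\<in>S. \<forall>z\<in>S. \<rho> x y \<le> e' * \<rho> x z \<longrightarrow> d x y \<le> e * d x z" if e: "e > 0" for e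
  proof -
    have "1 / e > 0" using e by simp
    then obtain M where M: "M > 0" "\<And>x y z. x \<in> S \<Longrightarrow> y \<in> S \<Longrightarrow> z \<in> S \<Longrightarrow>
        d x y \<le> 1 / e * d x z \<Longrightarrow> \<rho> x y \<le> M * \<rho> x z"
      using qs unfolding qs_comparable_def by meson
    have "d x y \<le> e * d x z"
      if S: "x \<in> S" "y \<in> S" "z \<in> S" and le: "\<rho> x y \<le> 1 / (2 * M) * \<rho> x z" for x y z
    proof (rule ccontr)
      assume lt: "\<not> d x y \<le> e * d x z"
      then have "d x z \<le> 1 / e * d x y" using e by (simp add: field_simps)
      then have "\<rho> x z \<le> M * \<rho> x y" using M(2)[OF S(1,3,2)] by simp
      also have "\<dots> \<le> 1 / 2 * \<rho> x z"
        using le M(1) mult_left_mono[of "\<rho> x y" "1 / (2 * M) * \<rho> x z" M] by simp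
      finally have "\<rho> x z = 0" using r.nonneg[of x z] by simp
      then have "x = z" using S by simp
      have "\<rho> x y = 0" using \<open>\<rho> x z = 0\<close> le r.nonneg[of x y] by simp
      then have "x = y" using S by simp
      then show False using lt S \<open>x = z\<close> by simp
    qed
    then show ?thesis using M(1) by (intro exI[of _ "1 / (2 * M)"]) auto
  qed
  show ?thesis using big small unfolding qs_comparable_def by blast
qed

lemma qs_comparable_large:
  assumes "qs_comparable S d \<rho>" "K > 0"
  obtains M where "M > 0"
    "\<And>x y z. x \<in> S \<Longrightarrow> y \<in> S \<Longrightarrow> z \<in> S \<Longrightarrow> d x y \<le> K * d x z \<Longrightarrow> \<rho> x y \<le> M * \<rho> x z"
  using assms unfolding qs_comparable_def by meson

lemma qs_comparable_small:
  assumes "qs_comparable S d \<rho>" "e > 0"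
  obtains e' where "e' > 0"
    "\<And>x y z. x \<in> S \<Longrightarrow> y \<in> S \<Longrightarrow> z \<in> S \<Longrightarrow> d x y \<le> e' * d x z \<Longrightarrow> \<rho> x y \<le> e * \<rho> x z"
  using assms unfolding qs_comparable_def by meson

text \<open>The minimum \<open>0\<close> of a strictly monotone function cannot be attained at an interior point \<open>p\<close>.\<close>

lemma homeomorphism_halfline_0:
  fixes \<eta> \<eta>' :: "real \<Rightarrow> real"
  assumes h: "homeomorphism {0..} {0..} \<eta> \<eta>'"
  shows "\<eta> 0 = 0"
proof (rule ccontr)
  assume n0: "\<eta> 0 \<noteq> 0"
  have cont: "continuous_on {0..} \<eta>" and im: "\<eta> ` {0..} = {0..}"
    using h by (simp_all add: homeomorphism_def)
  have inj: "inj_on \<eta> {0..}"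
    by (rule inj_on_inverseI[where g = \<eta>']) (use h in \<open>simp add: homeomorphism_def\<close>)
  obtain p where p: "p \<ge> 0" "\<eta> p = 0"
    using im by (force simp: set_eq_iff image_iff)
  with n0 have p0: "0 < p" by (cases "p = 0") auto
  have "inj_on \<eta> {0..p + 1}" "continuous_on {0..p + 1} \<eta>"
    using inj cont by (auto intro: inj_on_subset continuous_on_subset)
  then have "\<eta> 0 < \<eta> p \<and> \<eta> p < \<eta> (p + 1) \<or> \<eta> (p + 1) < \<eta> p \<and> \<eta> p < \<eta> 0"
    using p0 by (intro continuous_inj_imp_mono) auto
  moreover have "\<eta> 0 \<ge> 0" "\<eta> (p + 1) \<ge> 0" using im p0 by auto
  ultimately show False using p by linarith
qed

lemma quasisymmetry_imp_qs_comparable: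
  assumes d: "Metric_space S d" and r: "Metric_space S (\<lambda>x y. \<rho> (\<phi> x) (\<phi> y))"
    and qs: "quasisymmetry S d T \<rho> \<phi>"
  shows "qs_comparable S d (\<lambda>x y. \<rho> (\<phi> x) (\<phi> y))"
proof -
  interpret d: Metric_space S d by fact
  interpret r: Metric_space S "\<lambda>x y. \<rho> (\<phi> x) (\<phi> y)" by fact
  obtain \<eta> \<eta>' :: "real \<Rightarrow> real" where h: "homeomorphism {0..} {0..} \<eta> \<eta>'"
    and q: "\<And>x y z. x \<in> S \<Longrightarrow> y \<in> S \<Longrightarrow> z \<in> S \<Longrightarrow> x \<noteq> z \<Longrightarrow>
       \<rho> (\<phi> x) (\<phi> y) / \<rho> (\<phi> x) (\<phi> z) \<le> \<eta> (d x y / d x z)"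
    using qs unfolding quasisymmetry_def by blast
  have cont: "continuous_on {0..} \<eta>" using h by (auto simp: homeomorphism_def)
  have step: "\<rho> (\<phi> x) (\<phi> y) \<le> M * \<rho> (\<phi> x) (\<phi> z)"
    if S: "x \<in> S" "y \<in> S" "z \<in> S" and le: "d x y \<le> K * d x z"
      and M: "\<And>t. 0 \<le> t \<Longrightarrow> t \<le> K \<Longrightarrow> \<eta> t \<le> M" for x y z K M
  proof (cases "x = z")
    case True
    then have "d x z = 0" using S by simp
    then have "d x y = 0" using le d.nonneg[of x y] by simp
    then have "x = y" using S by simp
    then show ?thesis using True S by simp
  next
    case False
    have "0 < d x z" "0 < \<rho> (\<phi> x) (\<phi> z)"
      using False S d.mdist_pos_less r.mdist_pos_less by auto
    moreover have "\<eta> (d x y / d x z) \<le> M"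
      using le \<open>0 < d x z\<close> by (intro M) (auto simp: field_simps)
    moreover have "\<rho> (\<phi> x) (\<phi> y) / \<rho> (\<phi> x) (\<phi> z) \<le> \<eta> (d x y / d x z)" by (rule q[OF S False])
    ultimately have "\<rho> (\<phi> x) (\<phi> y) / \<rho> (\<phi> x) (\<phi> z) \<le> M" by linarith
    then show ?thesis using \<open>0 < \<rho> (\<phi> x) (\<phi> z)\<close> by (simp add: pos_divide_le_eq)
  qed
  show ?thesis unfolding qs_comparable_def
  proof (intro conjI allI impI)
    fix K :: real assume "K > 0"
    have "compact (\<eta> ` {0..K})"
      by (intro compact_continuous_image continuous_on_subset[OF cont]) auto
    then obtain B where B: "\<And>t. t \<in> {0..K} \<Longrightarrow> \<bar>\<eta> t\<bar> \<le> B"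
      by (metis bounded_iff compact_imp_bounded image_eqI real_norm_def)
    have "\<eta> t \<le> \<bar>B\<bar> + 1" if "0 \<le> t" "t \<le> K" for t using B[of t] that by auto
    then show "\<exists>M>0. \<forall>x\<in>S. \<forall>y\<in>S. \<forall>z\<in>S.
        d x y \<le> K * d x z \<longrightarrow> \<rho> (\<phi> x) (\<phi> y) \<le> M * \<rho> (\<phi> x) (\<phi> z)"
      using step[of _ _ _ K "\<bar>B\<bar> + 1"] by (intro exI[of _ "\<bar>B\<bar> + 1"]) auto
  next
    fix e :: real assume e: "e > 0"
    obtain s where s: "s > 0" "\<And>t. t \<in> {0..} \<Longrightarrow> dist t 0 < s \<Longrightarrow> dist (\<eta> t) (\<eta> 0) < e"
      using cont e unfolding continuous_on_iff by (metis atLeast_iff order_refl)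
    have "\<eta> t \<le> e" if "0 \<le> t" "t \<le> s / 2" for t
      using s(1) s(2)[of t] that homeomorphism_halfline_0[OF h] by (simp add: dist_real_def)
    then show "\<exists>e'>0. \<forall>x\<in>S. \<forall>y\<in>S. \<forall>z\<in>S.
        d x y \<le> e' * d x z \<longrightarrow> \<rho> (\<phi> x) (\<phi> y) \<le> e * \<rho> (\<phi> x) (\<phi> z)"
      using step[of _ _ _ "s / 2" e] s(1) by (intro exI[of _ "s / 2"]) auto
  qed
qed

lemma snowflake_imp_qs_comparable:
  fixes a C :: real
  assumes d: "Metric_space S d" and a: "a > 0" and C: "C \<ge> 1"
    and lo: "\<And>x y. x \<in> S \<Longrightarrow> y \<in> S \<Longrightarrow> 1 / C * d x y powr a \<le> \<rho> x y"
    and up: "\<And>x y. x \<in> S \<Longrightarrow> y \<in> S \<Longrightarrow> \<rho> x y \<le> C * d x y powr a"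
  shows "qs_comparable S d \<rho>"
proof -
  interpret d: Metric_space S d by fact
  have step: "\<rho> x y \<le> C\<^sup>2 * K powr a * \<rho> x z"
    if S: "x \<in> S" "y \<in> S" "z \<in> S" and K: "K > 0" and le: "d x y \<le> K * d x z" for x y z K
  proof -
    have "\<rho> x y \<le> C * d x y powr a" by (rule up) fact+
    also have "\<dots> \<le> C * (K * d x z) powr a"
      using le a C by (intro mult_left_mono powr_mono2) auto
    also have "\<dots> = C\<^sup>2 * K powr a * (1 / C * d x z powr a)"
      using K C by (simp add: powr_mult power2_eq_square)
    also have "\<dots> \<le> C\<^sup>2 * K powr a * \<rho> x z"
      using lo[OF S(1,3)] by (intro mult_left_mono) auto
    finally show ?thesis .
  qed
  show ?thesis unfolding qs_comparable_def
  proof (intro conjI allI impI)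
    fix K :: real assume "K > 0"
    then show "\<exists>M>0. \<forall>x\<in>S. \<forall>y\<in>S. \<forall>z\<in>S. d x y \<le> K * d x z \<longrightarrow> \<rho> x y \<le> M * \<rho> x z"
      using step[OF _ _ _ \<open>K > 0\<close>] C by (intro exI[of _ "C\<^sup>2 * K powr a"] conjI ballI impI) simp_all
  next
    fix e :: real assume e: "e > 0"
    define K where "K = (e / C\<^sup>2) powr (1 / a)"
    have K: "K > 0" using e C by (simp add: K_def)
    have Ke: "C\<^sup>2 * K powr a = e"
      using e C a by (simp add: K_def powr_powr)
    then show "\<exists>e'>0. \<forall>x\<in>S. \<forall>y\<in>S. \<forall>z\<in>S. d x y \<le> e' * d x z \<longrightarrow> \<rho> x y \<le> e * \<rho> x z"
      using step[OF _ _ _ K] K unfolding Ke by blast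
  qed
qed

section \<open>Uniform perfectness\<close>

text \<open>The quantitative form of uniform perfectness that is used: half-open annuli of a fixed ratio \<open>l\<close>, in
  place of the difference of an open ball and the closure of a smaller one.\<close>

definition has_annuli :: "'a set \<Rightarrow> ('a \<Rightarrow> 'a \<Rightarrow> real) \<Rightarrow> real \<Rightarrow> bool" where
  "has_annuli S d l \<longleftrightarrow>
     (\<forall>x\<in>S. \<forall>r. 0 < r \<and> r \<le> mdiam d S \<longrightarrow> (\<exists>z\<in>S. l * r \<le> d x z \<and> d x z < r))"

lemma uniformly_perfect_has_annuli:
  assumes d: "Metric_space S d" and up: "uniformly_perfect S d"
  obtains l where "0 < l" "has_annuli S d l"
proof -
  interpret d: Metric_space S d by fact
  obtain l where l: "0 < l"
    and p: "\<And>x r. x \<in> S \<Longrightarrow> 0 < r \<Longrightarrow> r \<le> mdiam d S \<Longrightarrow>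
       d.mball x r - (d.mtopology closure_of d.mball x (l * r)) \<noteq> {}"
    using up unfolding uniformly_perfect_def by blast
  have "\<exists>z\<in>S. l * r \<le> d x z \<and> d x z < r" if x: "x \<in> S" and r: "0 < r" "r \<le> mdiam d S" for x r
  proof -
    obtain z where z: "z \<in> d.mball x r" "z \<notin> d.mtopology closure_of d.mball x (l * r)"
      using p[OF x r] by blast
    moreover have "d.mball x (l * r) \<subseteq> d.mtopology closure_of d.mball x (l * r)"
      by (intro closure_of_subset) auto
    ultimately have "z \<notin> d.mball x (l * r)" by blast
    then show ?thesis using z(1) by (auto simp: not_less)
  qed
  then show ?thesis using that[OF l] unfolding has_annuli_def by blast
qed

text \<open>Given a \<open>\<rho>\<close>-ball of radius \<open>s\<close> around \<open>x\<close>, let \<open>R\<close> be the \<open>d\<close>-distance from \<open>x\<close> to its complement. A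
  point \<open>z\<close> with \<open>d x z\<close> slightly smaller than \<open>R\<close>, which uniform perfectness of \<open>d\<close> provides, lies in
  the \<open>\<rho>\<close>-ball. It is \<open>\<rho>\<close>-far from \<open>x\<close>, because it is \<open>d\<close>-comparable to a point \<open>y\<close> of the complement.\<close>

lemma has_annuli_qs_comparable:
  assumes d: "Metric_space S d" and r: "Metric_space S \<rho>"
    and bd: "Metric_space.mbounded S d S"
    and l: "0 < l" "has_annuli S d l" and qs: "qs_comparable S d \<rho>"
  obtains l' where "0 < l'" "has_annuli S \<rho> l'"
proof -
  interpret d: Metric_space S d by fact
  interpret r: Metric_space S \<rho> by fact
  obtain M where M: "M > 0" "\<And>x y z. x \<in> S \<Longrightarrow> y \<in> S \<Longrightarrow> z \<in> S \<Longrightarrow>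
      d x y \<le> 2 / l * d x z \<Longrightarrow> \<rho> x y \<le> M * \<rho> x z"
    using qs_comparable_large[OF qs, of "2 / l"] l(1) by auto
  define l' where "l' = min (1 / 4) (1 / M)"
  have l': "0 < l'" "l' \<le> 1 / 4" "l' \<le> 1 / M" using M(1) by (auto simp: l'_def)
  have "\<exists>z\<in>S. l' * s \<le> \<rho> x z \<and> \<rho> x z < s"
    if x: "x \<in> S" and s: "0 < s" "s \<le> mdiam \<rho> S" for x s
  proof (cases "\<exists>y\<in>S. s \<le> \<rho> x y")
    case False
    obtain z where z: "z \<in> S" "mdiam \<rho> S \<le> 4 * \<rho> x z"
      using r.far_point_exists[OF order_refl x] s by auto
    have "l' * s \<le> 1 / 4 * s" using l' s by (intro mult_right_mono) auto
    also have "\<dots> \<le> \<rho> x z" using z s by simp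
    finally show ?thesis using False z by (auto simp: not_le)
  next
    case True
    then obtain y0 where y0: "y0 \<in> S" "s \<le> \<rho> x y0" by blast
    define T where "T = {d x y | y. y \<in> S \<and> s \<le> \<rho> x y}"
    define R where "R = Inf T"
    have T: "T \<noteq> {}" "bdd_below T"
      using y0 by (auto simp: T_def intro!: bdd_belowI[where m = 0])
    have r0: "\<rho> x y0 > 0" using y0 s by simp
    then have d0: "d x y0 > 0" using x y0 by (intro d.mdist_pos_less) auto
    \<comment> \<open>Points that are \<open>d\<close>-close to \<open>x\<close> are \<open>\<rho>\<close>-close to it, whence \<open>R > 0\<close>.\<close>
    obtain e where e: "e > 0" "\<And>x' y z. x' \<in> S \<Longrightarrow> y \<in> S \<Longrightarrow> z \<in> S \<Longrightarrow>
        d x' y \<le> e * d x' z \<Longrightarrow> \<rho> x' y \<le> s / (2 * \<rho> x y0) * \<rho> x' z"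
      using qs_comparable_small[OF qs, of "s / (2 * \<rho> x y0)"] s(1) r0 by (metis divide_pos_pos mult_pos_pos zero_less_numeral)
    have "e * d x y0 \<le> t" if "t \<in> T" for t
    proof (rule ccontr)
      assume "\<not> e * d x y0 \<le> t"
      with that obtain y where y: "y \<in> S" "s \<le> \<rho> x y" "d x y < e * d x y0"
        by (auto simp: T_def)
      then have "\<rho> x y \<le> s / (2 * \<rho> x y0) * \<rho> x y0" using e(2)[OF x y(1) y0(1)] by simp
      then show False using y(2) s(1) r0 by simp
    qed
    then have "e * d x y0 \<le> R" unfolding R_def using T by (intro cInf_greatest) auto
    moreover have "e * d x y0 > 0" using e d0 by simp
    ultimately have R0: "R > 0" by simp
    have Rlow: "R \<le> d x y" if "y \<in> S" "s \<le> \<rho> x y" for y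
      unfolding R_def using that T by (intro cInf_lower) (auto simp: T_def)
    have "Inf T < 2 * R" using R0 by (simp add: R_def)
    then obtain y where y: "y \<in> S" "s \<le> \<rho> x y" "d x y < 2 * R"
      using cInf_lessD[OF T(1)] by (auto simp: T_def)
    have "R \<le> mdiam d S"
      using Rlow[OF y0] d.le_mdiam[OF bd order_refl x y0(1)] by simp
    then obtain z where z: "z \<in> S" "l * R \<le> d x z" "d x z < R"
      using l(2) x R0 unfolding has_annuli_def by blast
    have zs: "\<rho> x z < s" using Rlow[OF z(1)] z(3) by force
    have "d x y \<le> 2 * R" using y by simp
    also have "\<dots> \<le> 2 / l * d x z" using z(2) l(1) by (simp add: field_simps)
    finally have "\<rho> x y \<le> M * \<rho> x z" using M(2) x y z by blast
    then have "s \<le> M * \<rho> x z" using y by simp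
    then have "1 / M * s \<le> \<rho> x z" using M(1) by (simp add: field_simps)
    moreover have "l' * s \<le> 1 / M * s" using l' s by (intro mult_right_mono) auto
    ultimately have "l' * s \<le> \<rho> x z" by simp
    then show ?thesis using zs z by blast
  qed
  then show ?thesis using that[OF l'(1)] unfolding has_annuli_def by blast
qed

section \<open>Visual approximations under a change of metric\<close>

lemma visual_approximation_bounds:
  assumes "visual_approximation S d w L W"
  obtains C where "C \<ge> 1"
    "\<And>n X. X \<in> W n \<Longrightarrow> 1 / C * L powr (- real n) \<le> mdiam d X"
    "\<And>n X. X \<in> W n \<Longrightarrow> mdiam d X \<le> C * L powr (- real n)"
    "\<And>n X Y. X \<in> W n \<Longrightarrow> Y \<in> W n \<Longrightarrow> tile_nbhd (W n) w X \<inter> tile_nbhd (W n) w Y = {} \<Longrightarrow>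
        1 / C * L powr (- real n) \<le> msetdist d X Y"
proof -
  have "\<exists>C\<ge>1. \<forall>n.
        (\<forall>X\<in>W n. 1 / C * L powr (- real n) \<le> mdiam d X \<and> mdiam d X \<le> C * L powr (- real n)) \<and>
        (\<forall>X\<in>W n. \<forall>Y\<in>W n. tile_nbhd (W n) w X \<inter> tile_nbhd (W n) w Y = {} \<longrightarrow>
           msetdist d X Y \<ge> 1 / C * L powr (- real n))"
    using assms unfolding visual_approximation_def by (elim conjE)
  then obtain C where "C \<ge> 1" and all: "\<And>n.
        (\<forall>X\<in>W n. 1 / C * L powr (- real n) \<le> mdiam d X \<and> mdiam d X \<le> C * L powr (- real n)) \<and>
        (\<forall>X\<in>W n. \<forall>Y\<in>W n. tile_nbhd (W n) w X \<inter> tile_nbhd (W n) w Y = {} \<longrightarrow>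
           msetdist d X Y \<ge> 1 / C * L powr (- real n))"
    by (elim exE conjE) metis
  then show ?thesis by (intro that[of C]) simp_all
qed

text \<open>Let two sets meet in \<open>p\<close>. Each of them contains a point \<open>z\<close> whose \<open>\<rho>\<close>-distance to \<open>p\<close> is comparable
  to \<open>L\<close> to the power minus its level, and all points of the other one are \<open>\<rho>\<close>-close to \<open>p\<close> at their own
  scale. Comparability transfers the ratio of these distances to \<open>d\<close>: a bounded ratio for neighboring
  levels, an arbitrarily small one for distant levels. The same argument, based at a point of one of two
  separated sets, gives their relative distance.\<close>

lemma visual_approximation_qs_comparable:
  assumes V: "visual_approximation S \<rho> w L W"
    and d: "Metric_space S d" and bd: "Metric_space.mbounded S d S"
    and two: "\<exists>x\<in>S. \<exists>y\<in>S. x \<noteq> y" and qs: "qs_comparable S d \<rho>"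
  shows "quasi_visual_approximation S d w W"
proof -
  have r: "Metric_space S \<rho>" and rb: "Metric_space.mbounded S \<rho> S" and L: "L > 1"
    and cov: "cover_seq S W" and W0: "W 0 = {S}"
    using V by (auto simp: visual_approximation_def)
  interpret d: Metric_space S d by fact
  interpret r: Metric_space S \<rho> by fact
  obtain C where C: "C \<ge> 1"
    and lo: "\<And>n X. X \<in> W n \<Longrightarrow> 1 / C * L powr (- real n) \<le> mdiam \<rho> X"
    and up: "\<And>n X. X \<in> W n \<Longrightarrow> mdiam \<rho> X \<le> C * L powr (- real n)"
    and sep: "\<And>n X Y. X \<in> W n \<Longrightarrow> Y \<in> W n \<Longrightarrow> tile_nbhd (W n) w X \<inter> tile_nbhd (W n) w Y = {} \<Longrightarrow>
        1 / C * L powr (- real n) \<le> msetdist \<rho> X Y"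
    using visual_approximation_bounds[OF V] by blast
  have sub: "X \<subseteq> S" if "X \<in> W n" for X n using cov that by (auto simp: cover_seq_def)
  have pos: "mdiam \<rho> X > 0" if "X \<in> W n" for X n
    using lo[OF that] C L by (smt (verit) divide_pos_pos mult_pos_pos powr_gt_zero)
  have ne: "X \<noteq> {}" if "X \<in> W n" for X n
    using pos[OF that] by (rule mdiam_pos_imp_nonempty)
  have close: "\<rho> p x \<le> C * L powr (- real n)" if "X \<in> W n" "p \<in> X" "x \<in> X" for p x X n
    using r.le_mdiam[OF rb sub[OF that(1)] that(2,3)] up[OF that(1)] by simp
  have far: "\<exists>z\<in>X. 1 / (4 * C) * L powr (- real n) \<le> \<rho> p z" if X: "X \<in> W n" "p \<in> X" for p X n
  proof -
    obtain z where "z \<in> X" "mdiam \<rho> X \<le> 4 * \<rho> p z"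
      using r.far_point_exists[OF sub[OF X(1)] X(2) pos[OF X(1)]] by blast
    then show ?thesis using lo[OF X(1)] by (intro bexI[of _ z]) auto
  qed
  \<comment> \<open>The diameters of two meeting sets are compared at a common point.\<close>
  have compare: "mdiam d Y \<le> 2 * (M * mdiam d X)"
    if X: "X \<in> W n" and Y: "Y \<in> W m" and XY: "X \<inter> Y \<noteq> {}"
      and K: "C * L powr (- real m) \<le> K * (1 / (4 * C) * L powr (- real n))" "K > 0" "M > 0"
      and M: "\<And>x y z. x \<in> S \<Longrightarrow> y \<in> S \<Longrightarrow> z \<in> S \<Longrightarrow> \<rho> x y \<le> K * \<rho> x z \<Longrightarrow> d x y \<le> M * d x z"
    for X Y n m K M
  proof -
    obtain p where p: "p \<in> X" "p \<in> Y" using XY by blast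
    obtain z where z: "z \<in> X" "1 / (4 * C) * L powr (- real n) \<le> \<rho> p z"
      using far[OF X p(1)] by blast
    show ?thesis
    proof (rule d.mdiam_le_twice[OF sub[OF Y] p(2)])
      fix y assume y: "y \<in> Y"
      have "\<rho> p y \<le> C * L powr (- real m)" by (rule close[OF Y p(2) y])
      also have "\<dots> \<le> K * (1 / (4 * C) * L powr (- real n))" by (rule K)
      also have "\<dots> \<le> K * \<rho> p z" using z K by (intro mult_left_mono) auto
      finally have "d p y \<le> M * d p z" using M sub X Y p y z by (meson subsetD)
      also have "\<dots> \<le> M * mdiam d X"
        using K d.le_mdiam[OF bd sub[OF X] p(1) z(1)] by (intro mult_left_mono) auto
      finally show "d p y \<le> M * mdiam d X" .
    qed
  qed
  have qs': "qs_comparable S \<rho> d" by (rule qs_comparable_sym[OF d r qs])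
  \<comment> \<open>The factor \<open>L\<close> in \<open>K\<close> allows for levels that differ by one.\<close>
  define K where "K = 4 * C * C * L"
  have K: "K > 0" using C L by (simp add: K_def)
  obtain M where M: "M > 0" "\<And>x y z. x \<in> S \<Longrightarrow> y \<in> S \<Longrightarrow> z \<in> S \<Longrightarrow>
      \<rho> x y \<le> K * \<rho> x z \<Longrightarrow> d x y \<le> M * d x z"
    using qs_comparable_large[OF qs' K] by blast
  have nearby: "mdiam d Y \<le> 2 * (M * mdiam d X)"
    if "X \<in> W n" "Y \<in> W m" "X \<inter> Y \<noteq> {}" "n \<le> m + 1" for X Y n m
  proof (rule compare[OF that(1-3) _ K M])
    have "L powr (- real m) \<le> L powr (1 - real n)"
      using that(4) L by (intro powr_mono) auto
    also have "\<dots> = L * L powr (- real n)" using L by (simp add: powr_diff powr_minus divide_inverse)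
    finally have "C * L powr (- real m) \<le> C * (L * L powr (- real n))"
      using C by (intro mult_left_mono) auto
    then show "C * L powr (- real m) \<le> K * (1 / (4 * C) * L powr (- real n))"
      using C by (simp add: K_def field_simps)
  qed
  obtain e where e: "e > 0" "\<And>x y z. x \<in> S \<Longrightarrow> y \<in> S \<Longrightarrow> z \<in> S \<Longrightarrow>
      \<rho> x y \<le> e * \<rho> x z \<Longrightarrow> d x y \<le> 1 / 4 * d x z"
    using qs_comparable_small[OF qs', of "1 / 4"] by auto
  obtain k where k: "1 / L ^ k < e / (4 * C * C)"
  proof -
    have "0 < e / (4 * C * C)" using e C by simp
    then obtain k where "(1 / L) ^ k < e / (4 * C * C)"
      using real_arch_pow_inv[of "e / (4 * C * C)" "1 / L"] L by auto
    then show ?thesis using that by (auto simp: power_one_over)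
  qed
  \<comment> \<open>A positive number of levels is required, also when \<open>k = 0\<close> would do.\<close>
  define k0 where "k0 = Suc k"
  have shrink: "mdiam d Y \<le> 1 / 2 * mdiam d X"
    if "X \<in> W n" "Y \<in> W (n + k0)" "X \<inter> Y \<noteq> {}" for X Y n
  proof -
    have "L powr (- real (n + k0)) \<le> L powr (- real n - real k)"
      using L by (intro powr_mono) (auto simp: k0_def)
    also have "\<dots> = (1 / L ^ k) * L powr (- real n)"
      using L by (simp add: powr_diff powr_realpow)
    also have "\<dots> \<le> e / (4 * C * C) * L powr (- real n)"
      using k by (intro mult_right_mono) auto
    finally have "C * L powr (- real (n + k0)) \<le> C * (e / (4 * C * C) * L powr (- real n))"
      using C by (intro mult_left_mono) auto
    then have "C * L powr (- real (n + k0)) \<le> e * (1 / (4 * C) * L powr (- real n))"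
      using C by (simp add: field_simps)
    from compare[OF that this e(1) _ e(2)] show ?thesis by simp
  qed
  have separated: "mdiam d X \<le> 2 * M * msetdist d X Y"
    if X: "X \<in> W n" and Y: "Y \<in> W n" and dj: "tile_nbhd (W n) w X \<inter> tile_nbhd (W n) w Y = {}" for X Y n
  proof -
    have "mdiam d X / (2 * M) \<le> msetdist d X Y"
    proof (rule msetdist_ge[OF ne[OF X] ne[OF Y]])
      fix x y assume xy: "x \<in> X" "y \<in> Y"
      have "1 / C * L powr (- real n) \<le> \<rho> x y"
        using sep[OF X Y dj] r.msetdist_le[OF xy] by simp
      then have far: "C * C * (1 / C * L powr (- real n)) \<le> C * C * \<rho> x y"
        using C by (intro mult_left_mono) auto
      have "mdiam d X \<le> 2 * (M * d x y)"
      proof (rule d.mdiam_le_twice[OF sub[OF X] xy(1)])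
        fix x' assume x': "x' \<in> X"
        have "\<rho> x x' \<le> C * L powr (- real n)" by (rule close[OF X xy(1) x'])
        also have "\<dots> \<le> C * C * \<rho> x y" using far C by simp
        also have "\<dots> \<le> K * \<rho> x y"
        proof (rule mult_right_mono)
          have "C * C * 1 \<le> C * C * (4 * L)" using C L by (intro mult_left_mono) auto
          then show "C * C \<le> K" by (simp add: K_def)
        qed simp
        finally show "d x x' \<le> M * d x y" using M(2) sub X Y xy x' by (meson subsetD)
      qed
      then show "mdiam d X / (2 * M) \<le> d x y" using M(1) by (simp add: field_simps)
    qed
    then show ?thesis using M(1) by (simp add: field_simps)
  qed
  define D where "D = max 1 (2 * M)"
  have D: "D \<ge> 1" "2 * M \<le> D" by (auto simp: D_def)
  have dn: "0 \<le> mdiam d X" if X: "X \<in> W n" for X n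
  proof -
    obtain x where "x \<in> X" using ne[OF X] by blast
    then show ?thesis using d.le_mdiam[OF bd sub[OF X], of x x] d.nonneg[of x x] by linarith
  qed
  have D_nearby: "mdiam d Y \<le> D * mdiam d X"
    if "X \<in> W n" "Y \<in> W m" "X \<inter> Y \<noteq> {}" "n \<le> m + 1" for X Y n m
  proof -
    have "2 * M * mdiam d X \<le> D * mdiam d X" using D dn[OF that(1)] by (intro mult_right_mono)
    then show ?thesis using nearby[OF that] by simp
  qed
  have both: "1 / D * mdiam d Y \<le> mdiam d X \<and> mdiam d X \<le> D * mdiam d Y"
    if "X \<in> W n" "Y \<in> W m" "X \<inter> Y \<noteq> {}" "n \<le> m + 1" "m \<le> n + 1" for X Y n m
    using D_nearby[OF that(1-4)] D_nearby[of Y m X n] that D by (auto simp: field_simps)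
  have D_sep: "1 / D * mdiam d X \<le> msetdist d X Y"
    if "X \<in> W n" "Y \<in> W n" "tile_nbhd (W n) w X \<inter> tile_nbhd (W n) w Y = {}" for X Y n
  proof -
    have "0 \<le> msetdist d X Y"
      by (rule msetdist_ge[OF ne[OF that(1)] ne[OF that(2)]]) simp
    then have "2 * M * msetdist d X Y \<le> D * msetdist d X Y" using D by (intro mult_right_mono)
    then show ?thesis using separated[OF that] D by (simp add: field_simps)
  qed
  have "(\<forall>X\<in>W n. \<forall>Y\<in>W n. X \<inter> Y \<noteq> {} \<longrightarrow>
           1 / D * mdiam d Y \<le> mdiam d X \<and> mdiam d X \<le> D * mdiam d Y) \<and>
        (\<forall>X\<in>W n. \<forall>Y\<in>W n. tile_nbhd (W n) w X \<inter> tile_nbhd (W n) w Y = {} \<longrightarrow>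
           msetdist d X Y \<ge> 1 / D * mdiam d X) \<and>
        (\<forall>X\<in>W n. \<forall>Y\<in>W (n + 1). X \<inter> Y \<noteq> {} \<longrightarrow>
           1 / D * mdiam d Y \<le> mdiam d X \<and> mdiam d X \<le> D * mdiam d Y) \<and>
        (\<forall>X\<in>W n. \<forall>Y\<in>W (n + k0). X \<inter> Y \<noteq> {} \<longrightarrow> mdiam d Y \<le> 1 / 2 * mdiam d X)" for n
    using both[of _ n _ n] both[of _ n _ "n + 1"] D_sep shrink by auto
  then show ?thesis
    unfolding quasi_visual_approximation_def
    using d bd two cov W0 D(1)
    by (intro conjI exI[of _ D] exI[of _ k0] exI[of _ "1 / 2 :: real"]) (auto simp: k0_def)
qed

lemma visual_approximation_snowflake:
  fixes a C :: real
  assumes V: "visual_approximation S \<rho> w L W"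
    and d: "Metric_space S d" and bd: "Metric_space.mbounded S d S"
    and a: "a > 0" and C: "C \<ge> 1"
    and lo: "\<And>x y. x \<in> S \<Longrightarrow> y \<in> S \<Longrightarrow> 1 / C * d x y powr a \<le> \<rho> x y"
    and up: "\<And>x y. x \<in> S \<Longrightarrow> y \<in> S \<Longrightarrow> \<rho> x y \<le> C * d x y powr a"
  shows "visual_approximation S d w (L powr (1 / a)) W"
proof -
  have r: "Metric_space S \<rho>" and rb: "Metric_space.mbounded S \<rho> S" and L: "L > 1"
    and cov: "cover_seq S W" and W0: "W 0 = {S}"
    using V by (auto simp: visual_approximation_def)
  interpret d: Metric_space S d by fact
  interpret r: Metric_space S \<rho> by fact
  obtain B where B: "B \<ge> 1"
    and Wlo: "\<And>n X. X \<in> W n \<Longrightarrow> 1 / B * L powr (- real n) \<le> mdiam \<rho> X"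
    and Wup: "\<And>n X. X \<in> W n \<Longrightarrow> mdiam \<rho> X \<le> B * L powr (- real n)"
    and sep: "\<And>n X Y. X \<in> W n \<Longrightarrow> Y \<in> W n \<Longrightarrow> tile_nbhd (W n) w X \<inter> tile_nbhd (W n) w Y = {} \<Longrightarrow>
        1 / B * L powr (- real n) \<le> msetdist \<rho> X Y"
    using visual_approximation_bounds[OF V] by blast
  have sub: "X \<subseteq> S" if "X \<in> W n" for X n using cov that by (auto simp: cover_seq_def)
  have pos: "mdiam \<rho> X > 0" if "X \<in> W n" for X n
    using Wlo[OF that] B L by (smt (verit) divide_pos_pos mult_pos_pos powr_gt_zero)
  have ne: "X \<noteq> {}" if "X \<in> W n" for X n
    using pos[OF that] by (rule mdiam_pos_imp_nonempty)
  \<comment> \<open>The 4 is lost when a diameter is replaced by distances from a given point.\<close>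
  define E where "E = (4 * B * C) powr (1 / a)"
  define q where "q n = (L powr (1 / a)) powr (- real n)" for n
  have "1 * 1 \<le> B * C" using B C by (intro mult_mono) auto
  then have BC: "1 \<le> 4 * B * C" by simp
  then have E: "E \<ge> 1" using a unfolding E_def by (intro ge_one_powr_ge_zero) auto
  have q: "q n = (L powr (- real n)) powr (1 / a)" for n
    by (simp add: q_def powr_powr mult.commute)
  \<comment> \<open>Taking the power \<open>1 / a\<close> turns bounds for \<open>\<rho>\<close> at scale \<open>L\<^sup>-\<^sup>n\<close> into bounds for \<open>d\<close> at scale \<open>q n\<close>.\<close>
  have dlow: "1 / E * q n \<le> d x y"
    if "x \<in> S" "y \<in> S" "1 / (4 * B) * L powr (- real n) \<le> \<rho> x y" for x y n
  proof -
    have "1 / (4 * B) * L powr (- real n) \<le> C * d x y powr a" using up[OF that(1,2)] that(3) by simp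
    then have "1 / (4 * B * C) * L powr (- real n) \<le> d x y powr a"
      using C B by (simp add: field_simps)
    then have "(1 / (4 * B * C) * L powr (- real n)) powr (1 / a) \<le> (d x y powr a) powr (1 / a)"
      using B C a by (intro powr_mono2) auto
    also have "\<dots> = d x y" using a by (simp add: powr_powr)
    finally show ?thesis
      using B C by (simp add: powr_mult powr_divide E_def q)
  qed
  have dup: "d x y \<le> E * q n"
    if "x \<in> S" "y \<in> S" "\<rho> x y \<le> B * L powr (- real n)" for x y n
  proof -
    have "1 / C * d x y powr a \<le> B * L powr (- real n)" using lo[OF that(1,2)] that(3) by simp
    then have "d x y powr a \<le> B * C * L powr (- real n)" using C by (simp add: field_simps)
    also have "\<dots> \<le> 4 * B * C * L powr (- real n)" using B C by (intro mult_right_mono) auto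
    finally have "(d x y powr a) powr (1 / a) \<le> (4 * B * C * L powr (- real n)) powr (1 / a)"
      using a by (intro powr_mono2) auto
    then show ?thesis using a B C by (simp add: powr_powr powr_mult E_def q)
  qed
  have dlow': "1 / E * q n \<le> mdiam d X" if X: "X \<in> W n" for X n
  proof -
    obtain p where p: "p \<in> X" using ne[OF X] by blast
    obtain z where z: "z \<in> X" "mdiam \<rho> X \<le> 4 * \<rho> p z"
      using r.far_point_exists[OF sub[OF X] p pos[OF X]] by blast
    have "1 / E * q n \<le> d p z" using Wlo[OF X] z p sub[OF X] by (intro dlow) auto
    also have "\<dots> \<le> mdiam d X" using d.le_mdiam[OF bd sub[OF X] p z(1)] .
    finally show ?thesis .
  qed
  have dup': "mdiam d X \<le> E * q n" if X: "X \<in> W n" for X n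
  proof (rule mdiam_le[OF ne[OF X]])
    fix x y assume xy: "x \<in> X" "y \<in> X"
    show "d x y \<le> E * q n"
      using r.le_mdiam[OF rb sub[OF X] xy] Wup[OF X] xy sub[OF X] by (intro dup) auto
  qed
  have dsep: "1 / E * q n \<le> msetdist d X Y"
    if X: "X \<in> W n" and Y: "Y \<in> W n" and dj: "tile_nbhd (W n) w X \<inter> tile_nbhd (W n) w Y = {}" for X Y n
  proof (rule msetdist_ge[OF ne[OF X] ne[OF Y]])
    fix x y assume xy: "x \<in> X" "y \<in> Y"
    have "1 / (4 * B) * L powr (- real n) \<le> 1 / B * L powr (- real n)"
      using B by (intro mult_right_mono) (auto simp: field_simps)
    also have "\<dots> \<le> \<rho> x y" using sep[OF X Y dj] r.msetdist_le[OF xy] by simp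
    finally show "1 / E * q n \<le> d x y"
      using xy sub[OF X] sub[OF Y] by (intro dlow) auto
  qed
  have "1 < L powr (1 / a)" using L a by (intro gr_one_powr) auto
  moreover have "(\<forall>X\<in>W n. 1 / E * q n \<le> mdiam d X \<and> mdiam d X \<le> E * q n) \<and>
        (\<forall>X\<in>W n. \<forall>Y\<in>W n. tile_nbhd (W n) w X \<inter> tile_nbhd (W n) w Y = {} \<longrightarrow>
           msetdist d X Y \<ge> 1 / E * q n)" for n
    using dlow' dup' dsep by blast
  ultimately show ?thesis
    unfolding visual_approximation_def using d bd cov W0 E unfolding q_def by blast
qed

section \<open>Distances in the tile graph\<close>

locale tile_graph =
  fixes S :: "'a set" and X :: "nat \<Rightarrow> 'a set set"
  assumes cover: "cover_seq S X"
    and nonempty: "A \<in> X n \<Longrightarrow> A \<noteq> {}"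
    and root: "X 0 = {S}"
begin

lemma tile_subset: "u \<in> tiles X \<Longrightarrow> snd u \<subseteq> S"
  using cover unfolding tiles_def cover_seq_def by fastforce

lemma tile_nonempty: "u \<in> tiles X \<Longrightarrow> snd u \<noteq> {}"
  using nonempty by (auto simp: tiles_def)

lemma tile_containing:
  assumes "x \<in> S"
  obtains A where "A \<in> X n" "x \<in> A"
  using assms cover by (auto simp: cover_seq_def)

lemma natural_geodesic_through:
  assumes u: "u \<in> tiles X" "x \<in> snd u"
  obtains g where "natural_geodesic X x g" "g (fst u) = u"
proof -
  have "\<forall>n. \<exists>A. A \<in> X n \<and> x \<in> A"
    using tile_containing tile_subset[OF u(1)] u(2) by (metis subsetD)
  then obtain A where A: "\<And>n. A n \<in> X n \<and> x \<in> A n" by metis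
  have "natural_geodesic X x (\<lambda>n. if n = fst u then u else (n, A n))"
    using A u by (auto simp: natural_geodesic_def tiles_def)
  then show ?thesis by (rule that) simp
qed

lemma natural_geodesic_relpow:
  assumes "natural_geodesic X x g"
  shows "(g 0, g n) \<in> tile_edges X ^^ n"
proof (induction n)
  case (Suc n)
  have "(g n, g (Suc n)) \<in> tile_edges X"
    using assms unfolding natural_geodesic_def tile_edges_def
    by (auto simp: prod_eq_iff dest: spec[of _ n] spec[of _ "Suc n"])
  then show ?case using Suc by (rule_tac relpow_Suc_I)
qed simp

lemma tile_edges_relpow_sym:
  "(u, v) \<in> tile_edges X ^^ k \<Longrightarrow> (v, u) \<in> tile_edges X ^^ k"
proof (induction k arbitrary: v)
  case (Suc k)
  then obtain c where "(u, c) \<in> tile_edges X ^^ k" "(c, v) \<in> tile_edges X"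
    by (rule_tac relpow_Suc_E)
  moreover from this have "(v, c) \<in> tile_edges X" by (auto simp: tile_edges_def abs_minus_commute)
  ultimately show ?case using Suc.IH by (blast intro: relpow_Suc_I2)
qed simp

lemma root_relpow:
  assumes u: "u \<in> tiles X"
  shows "((0, S), u) \<in> tile_edges X ^^ fst u"
proof -
  obtain x where x: "x \<in> snd u" using tile_nonempty[OF u] by blast
  obtain g where g: "natural_geodesic X x g" "g (fst u) = u"
    using natural_geodesic_through[OF u x] .
  have "g 0 \<in> tiles X" "fst (g 0) = 0" using g by (auto simp: natural_geodesic_def)
  then have "g 0 = (0, S)" using root by (auto simp: tiles_def prod_eq_iff)
  then show ?thesis using natural_geodesic_relpow[OF g(1), of "fst u"] g(2) by simp
qed

lemma tile_dist_relpow: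
  assumes "u \<in> tiles X" "v \<in> tiles X"
  shows "(u, v) \<in> tile_edges X ^^ tile_dist X u v"
proof -
  have "(u, v) \<in> tile_edges X ^^ (fst u + fst v)"
    using tile_edges_relpow_sym[OF root_relpow[OF assms(1)]] root_relpow[OF assms(2)]
    by (auto simp: relpow_add)
  then show ?thesis unfolding tile_dist_def by (rule LeastI)
qed

lemma tile_dist_refl [simp]: "tile_dist X u u = 0"
  using tile_dist_le[of u u 0 X] by simp

lemma relpow_level:
  "(u, v) \<in> tile_edges X ^^ k \<Longrightarrow> \<bar>real (fst u) - real (fst v)\<bar> \<le> real k"
proof (induction k arbitrary: v)
  case (Suc k)
  then obtain c where c: "(u, c) \<in> tile_edges X ^^ k" "(c, v) \<in> tile_edges X"
    by (rule_tac relpow_Suc_E)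
  then have "\<bar>real (fst u) - real (fst c)\<bar> \<le> real k" by (intro Suc.IH)
  moreover have "\<bar>int (fst c) - int (fst v)\<bar> \<le> 1" using c(2) by (simp add: tile_edges_def)
  then have "\<bar>real (fst c) - real (fst v)\<bar> \<le> 1" by linarith
  ultimately show ?case by simp
qed simp

lemma level_diff_le_tile_dist:
  assumes "u \<in> tiles X" "v \<in> tiles X"
  shows "\<bar>real (fst u) - real (fst v)\<bar> \<le> real (tile_dist X u v)"
  using tile_dist_relpow[OF assms] by (rule relpow_level)

lemma gromov_prod_le_level:
  assumes "u \<in> tiles X" "v \<in> tiles X"
  shows "gromov_prod X u v \<le> real (fst u)" "gromov_prod X u v \<le> real (fst v)"
  using level_diff_le_tile_dist[OF assms] by (simp_all add: gromov_prod_def)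

lemma tile_dist_triangle:
  assumes "u \<in> tiles X" "v \<in> tiles X" "z \<in> tiles X"
  shows "tile_dist X u v \<le> tile_dist X u z + tile_dist X z v"
proof (rule tile_dist_le)
  show "(u, v) \<in> tile_edges X ^^ (tile_dist X u z + tile_dist X z v)"
    unfolding relpow_add
    by (rule relcompI[OF tile_dist_relpow[OF assms(1,3)] tile_dist_relpow[OF assms(3,2)]])
qed

lemma cluster_subset: "cluster X r u \<subseteq> S"
  unfolding cluster_def by (rule Union_least) (use tile_subset in blast)

lemma tile_subset_cluster: "u \<in> tiles X \<Longrightarrow> snd u \<subseteq> cluster X r u"
  unfolding cluster_def
  by (rule Union_upper, rule CollectI, rule exI[of _ u]) simp

lemma cover_seq_cluster_covers: "cover_seq S (cluster_covers X r)"
  unfolding cover_seq_def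
proof (intro allI equalityI)
  fix n
  show "\<Union> (cluster_covers X r n) \<subseteq> S" using cluster_subset by (auto simp: cluster_covers_def)
  show "S \<subseteq> \<Union> (cluster_covers X r n)"
  proof
    fix x assume "x \<in> S"
    then obtain A where A: "A \<in> X n" "x \<in> A" by (rule tile_containing)
    then have "x \<in> cluster X r (n, A)"
      using tile_subset_cluster[of "(n, A)" r] by (auto simp: tiles_def)
    then show "x \<in> \<Union> (cluster_covers X r n)" using A(1) by (auto simp: cluster_covers_def)
  qed
qed

lemma cluster_covers_0: "cluster_covers X r 0 = {S}"
proof -
  have "(0, S) \<in> tiles X" using root by (simp add: tiles_def)
  then have "cluster X r (0, S) = S"
    using cluster_subset tile_subset_cluster[of "(0, S)" r] by (metis snd_conv subset_antisym)
  then show ?thesis unfolding cluster_covers_def root by blast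
qed

end

lemma tile_nbhd_1_superset:
  fixes A B :: "'a set"
  assumes "A \<in> W" "B \<in> W" "A \<inter> B \<noteq> {}"
  shows "B \<subseteq> tile_nbhd W 1 A"
proof -
  define Z where "Z = (\<lambda>j::nat. if j = 0 then A else B)"
  have "Z 0 = A \<and> Z 1 = B \<and> (\<forall>j\<le>1. Z j \<in> W) \<and> (\<forall>j<1. Z j \<inter> Z (Suc j) \<noteq> {})"
    using assms by (simp add: Z_def)
  then have "B \<in> {Y \<in> W. \<exists>k\<le>1. \<exists>Z :: nat \<Rightarrow> 'a set. Z 0 = A \<and> Z k = Y \<and> (\<forall>j\<le>k. Z j \<in> W) \<and>
                 (\<forall>j<k. Z j \<inter> Z (Suc j) \<noteq> {})}"
    using assms(2,3) by (intro CollectI conjI exI[of _ "1::nat"] exI[of _ Z]) simp_all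
  then show ?thesis unfolding tile_nbhd_def by (rule Union_upper)
qed

section \<open>Hyperbolicity and the boundary map\<close>

locale hyperbolic_tile_graph = tile_graph +
  fixes \<delta> :: real
  assumes delta_nonneg: "\<delta> \<ge> 0"
    and hyperbolic: "u \<in> tiles X \<Longrightarrow> v \<in> tiles X \<Longrightarrow> z \<in> tiles X \<Longrightarrow>
          gromov_prod X u v \<ge> min (gromov_prod X u z) (gromov_prod X z v) - \<delta>"
begin

lemma gromov_hyperbolic: "gromov_hyperbolic X"
  unfolding gromov_hyperbolic_def using delta_nonneg hyperbolic by blast

lemma natural_geodesic_in_boundary_map:
  assumes "natural_geodesic X x g"
  shows "g \<in> boundary_map X x"
  using boundary_map_eq(1)[OF gromov_hyperbolic assms] natural_geodesic_equivalent[OF assms assms]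
  by auto

text \<open>Run natural geodesics of \<open>x\<close> and \<open>y\<close> through \<open>u\<close> and \<open>v\<close>. Two applications of hyperbolicity along
  \<open>g i, u, v, h i\<close> bound their Gromov products from below, where \<open>u\<close> and \<open>v\<close> cost at most the \<open>1 / 2\<close> of
  \<open>natural_geodesic_prod\<close>.\<close>

lemma boundary_prod_ge:
  assumes u: "u \<in> tiles X" "x \<in> snd u" and v: "v \<in> tiles X" "y \<in> snd v"
  shows "boundary_prod X (boundary_map X x) (boundary_map X y)
           \<ge> ereal (gromov_prod X u v - 1 / 2 - 2 * \<delta>)"
proof -
  obtain g where g: "natural_geodesic X x g" "g (fst u) = u" using natural_geodesic_through[OF u] .
  obtain h where h: "natural_geodesic X y h" "h (fst v) = v" using natural_geodesic_through[OF v] .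
  have t: "g i \<in> tiles X" "h i \<in> tiles X" for i using g h by (auto simp: natural_geodesic_def)
  have ge: "gromov_prod X u v - 1 / 2 - 2 * \<delta> \<le> gromov_prod X (g i) (h i)" if i: "i \<ge> fst u + fst v" for i
  proof -
    have "gromov_prod X (g i) u \<ge> real (fst u) - 1 / 2"
      using natural_geodesic_prod[OF g(1) g(1), of i "fst u"] g(2) i by simp
    moreover have "gromov_prod X v (h i) \<ge> real (fst v) - 1 / 2"
      using natural_geodesic_prod[OF h(1) h(1), of "fst v" i] h(2) i by simp
    moreover have "gromov_prod X (g i) v \<ge> min (gromov_prod X (g i) u) (gromov_prod X u v) - \<delta>"
      by (intro hyperbolic t u v)
    moreover have "gromov_prod X (g i) (h i) \<ge> min (gromov_prod X (g i) v) (gromov_prod X v (h i)) - \<delta>"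
      by (intro hyperbolic t v)
    ultimately show ?thesis
      using gromov_prod_le_level[OF u(1) v(1)] delta_nonneg by (simp add: min_def split: if_splits)
  qed
  have "ereal (gromov_prod X u v - 1 / 2 - 2 * \<delta>) \<le> liminf (\<lambda>i. ereal (gromov_prod X (g i) (h i)))"
    by (rule Liminf_bounded, rule eventually_sequentiallyI[of "fst u + fst v"]) (use ge in simp)
  also have "\<dots> \<le> boundary_prod X (boundary_map X x) (boundary_map X y)"
    unfolding boundary_prod_def
    using natural_geodesic_in_boundary_map[OF g(1)] natural_geodesic_in_boundary_map[OF h(1)]
    by (intro SUP_upper2[of "(g, h)"]) auto
  finally show ?thesis .
qed

text \<open>The boundary product is a supremum over all representatives \<open>s\<close> and \<open>t\<close>, so the natural geodesics
  \<open>g\<close> and \<open>h\<close> have to be compared with \<open>s\<close> and \<open>t\<close>: hyperbolicity is applied four times, along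
  \<open>u, g i, s i, t i, h i, v\<close>.\<close>

lemma gromov_prod_ge:
  assumes u: "u \<in> tiles X" "x \<in> snd u" "fst u = n" and v: "v \<in> tiles X" "y \<in> snd v" "fst v = n"
    and large: "boundary_prod X (boundary_map X x) (boundary_map X y) > ereal (real n)"
  shows "gromov_prod X u v \<ge> real n - 1 / 2 - 4 * \<delta>"
proof -
  obtain g where g: "natural_geodesic X x g" "g n = u" using natural_geodesic_through[OF u(1,2)] u(3) by auto
  obtain h where h: "natural_geodesic X y h" "h n = v" using natural_geodesic_through[OF v(1,2)] v(3) by auto
  obtain s t where st: "s \<in> boundary_map X x" "t \<in> boundary_map X y"
    and inf: "ereal (real n) < liminf (\<lambda>i. ereal (gromov_prod X (s i) (t i)))"
    using large unfolding boundary_prod_def less_SUP_iff by auto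
  have gs: "(g, s) \<in> boundary_rel X" and ht: "(h, t) \<in> boundary_rel X"
    using st boundary_map_eq(1)[OF gromov_hyperbolic g(1)] boundary_map_eq(1)[OF gromov_hyperbolic h(1)]
    by auto
  have tl: "g i \<in> tiles X" "h i \<in> tiles X" "s i \<in> tiles X" "t i \<in> tiles X" for i
    using gs ht by (auto simp: boundary_rel_def converges_at_infinity_def)
  have "\<forall>\<^sub>F i in sequentially. real n \<le> gromov_prod X (g i) (s i)"
    "\<forall>\<^sub>F i in sequentially. real n \<le> gromov_prod X (h i) (t i)"
    using gs ht by (auto simp: boundary_rel_def filterlim_at_top)
  moreover have "\<forall>\<^sub>F i in sequentially. ereal (real n) < ereal (gromov_prod X (s i) (t i))"
    by (rule less_LiminfD[OF inf])
  moreover have "\<forall>\<^sub>F i in sequentially. n \<le> i" by (rule eventually_ge_at_top)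
  ultimately have "\<forall>\<^sub>F i in sequentially. real n \<le> gromov_prod X (g i) (s i) \<and>
      real n \<le> gromov_prod X (h i) (t i) \<and> real n < gromov_prod X (s i) (t i) \<and> n \<le> i"
    by eventually_elim auto
  then obtain i where i: "real n \<le> gromov_prod X (g i) (s i)" "real n \<le> gromov_prod X (h i) (t i)"
     "real n < gromov_prod X (s i) (t i)" "n \<le> i"
    by (metis (no_types, lifting) eventually_happens trivial_limit_sequentially)
  have "gromov_prod X u (g i) \<ge> real n - 1 / 2"
    using natural_geodesic_prod[OF g(1) g(1), of n i] g(2) i by simp
  moreover have "gromov_prod X (h i) v \<ge> real n - 1 / 2"
    using natural_geodesic_prod[OF h(1) h(1), of i n] h(2) i by simp
  moreover have "gromov_prod X u (s i) \<ge> min (gromov_prod X u (g i)) (gromov_prod X (g i) (s i)) - \<delta>"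
    by (intro hyperbolic tl u)
  moreover have "gromov_prod X u (t i) \<ge> min (gromov_prod X u (s i)) (gromov_prod X (s i) (t i)) - \<delta>"
    by (intro hyperbolic tl u)
  moreover have "gromov_prod X u (h i) \<ge> min (gromov_prod X u (t i)) (gromov_prod X (t i) (h i)) - \<delta>"
    by (intro hyperbolic tl u)
  moreover have "gromov_prod X u v \<ge> min (gromov_prod X u (h i)) (gromov_prod X (h i) v) - \<delta>"
    by (intro hyperbolic tl u v)
  ultimately show ?thesis
    using i delta_nonneg gromov_prod_commute[of X "h i" "t i"] by linarith
qed

text \<open>Two tiles of level \<open>n\<close> with Gromov product at least \<open>n - 1 / 2 - 4 * \<delta>\<close> have distance at most
  \<open>1 + 8 * \<delta>\<close>; this is where the lower bound for the radius of the clusters comes from.\<close>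

lemma cluster_contains_large_boundary_prod:
  assumes r: "1 + 8 * \<delta> \<le> real r" and A: "A \<in> X n" "x \<in> A" and y: "y \<in> S"
    and large: "boundary_prod X (boundary_map X x) (boundary_map X y) > ereal (real n)"
  shows "y \<in> cluster X r (n, A)"
proof -
  obtain B where B: "B \<in> X n" "y \<in> B" using tile_containing[OF y] .
  have t: "(n, A) \<in> tiles X" "(n, B) \<in> tiles X" using A B by (auto simp: tiles_def)
  have "gromov_prod X (n, A) (n, B) \<ge> real n - 1 / 2 - 4 * \<delta>"
    using A B t large by (intro gromov_prod_ge) auto
  then have "real (tile_dist X (n, A) (n, B)) \<le> 1 + 8 * \<delta>" by (simp add: gromov_prod_def)
  then have "tile_dist X (n, A) (n, B) \<le> r" using r by simp
  then show ?thesis using t B by (force simp: cluster_def)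
qed

lemma boundary_prod_ge_of_cluster:
  assumes A: "A \<in> X n" and x: "x \<in> cluster X r (n, A)" and y: "y \<in> cluster X r (n, A)"
  shows "boundary_prod X (boundary_map X x) (boundary_map X y)
           \<ge> ereal (real n - 2 * real r - 1 / 2 - 2 * \<delta>)"
proof -
  have a: "(n, A) \<in> tiles X" using A by (simp add: tiles_def)
  obtain u where u: "u \<in> tiles X" "x \<in> snd u" "tile_dist X (n, A) u \<le> r"
    using x by (auto simp: cluster_def)
  obtain v where v: "v \<in> tiles X" "y \<in> snd v" "tile_dist X (n, A) v \<le> r"
    using y by (auto simp: cluster_def)
  have "real (fst u) \<ge> real n - real r" "real (fst v) \<ge> real n - real r"
    using level_diff_le_tile_dist[OF a u(1)] level_diff_le_tile_dist[OF a v(1)] u(3) v(3) by auto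
  moreover have "tile_dist X u v \<le> tile_dist X u (n, A) + tile_dist X (n, A) v"
    by (intro tile_dist_triangle u v a)
  then have "real (tile_dist X u v) \<le> 2 * real r"
    using u(3) v(3) tile_dist_commute[of X u "(n, A)"] by simp
  ultimately have "gromov_prod X u v \<ge> real n - 2 * real r" by (simp add: gromov_prod_def)
  then have "ereal (real n - 2 * real r - 1 / 2 - 2 * \<delta>) \<le> ereal (gromov_prod X u v - 1 / 2 - 2 * \<delta>)"
    by simp
  also note boundary_prod_ge[OF u(1,2) v(1,2)]
  finally show ?thesis .
qed

end

lemma neg_powr_le:
  assumes "L > 1" "b \<ge> ereal t"
  shows "neg_powr L b \<le> L powr (- t)"
  using assms by (cases b) (auto simp: neg_powr_def)

lemma less_of_neg_powr_less:
  assumes L: "L > 1" and less: "neg_powr L b < L powr (- t)" and t: "t \<ge> 0"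
  shows "ereal t < b"
proof (cases b)
  case (real s)
  then show ?thesis using L less by (simp add: neg_powr_def)
next
  case MInf
  have "L powr (- t) \<le> 1" using L t powr_mono[of "- t" 0 L] by simp
  then show ?thesis using less MInf L by (simp add: neg_powr_def)
qed simp

section \<open>Clusters as a visual approximation for the visual metric\<close>

context hyperbolic_tile_graph
begin

text \<open>Upper bound for the diameters: tiles in a cluster of level \<open>n\<close> have Gromov product at least \<open>n - 2 * r\<close>.
  The other two bounds rest on \<open>ball\<close>: a cluster contains \<open>\<rho>\<close>-balls around the points of its central tile.
  An annulus in such a ball contributes to the diameter. If \<open>x \<in> V\<close> and \<open>y \<in> V'\<close> are too close, then \<open>y\<close>
  lies both in a cluster around \<open>x\<close>, which meets \<open>V\<close>, and in a cluster around \<open>y\<close>, which meets \<open>V'\<close>; so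
  the neighborhoods of \<open>V\<close> and \<open>V'\<close> intersect.\<close>

lemma visual_approximation_cluster_covers:
  assumes r: "1 + 8 * \<delta> \<le> real r"
    and two: "\<exists>x\<in>S. \<exists>y\<in>S. x \<noteq> y"
    and metric: "Metric_space S \<rho>" and ann: "0 < l" "has_annuli S \<rho> l"
    and L: "L > 1" and C: "C \<ge> 1"
    and lo: "\<And>x y. x \<in> S \<Longrightarrow> y \<in> S \<Longrightarrow>
        1 / C * neg_powr L (boundary_prod X (boundary_map X x) (boundary_map X y)) \<le> \<rho> x y"
    and up: "\<And>x y. x \<in> S \<Longrightarrow> y \<in> S \<Longrightarrow>
        \<rho> x y \<le> C * neg_powr L (boundary_prod X (boundary_map X x) (boundary_map X y))"
  shows "visual_approximation S \<rho> 1 L (cluster_covers X r)"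
proof -
  interpret \<rho>: Metric_space S \<rho> by fact
  define q where "q n = L powr (- real n)" for n
  have q: "q n > 0" "q n \<le> 1" for n
    using L powr_mono[of "- real n" 0 L] by (auto simp: q_def)
  define E where "E = C * L powr (2 * real r + 1 / 2 + 2 * \<delta>)"
  have E: "\<rho> x y \<le> E * q n" if A: "A \<in> X n" "x \<in> cluster X r (n, A)" "y \<in> cluster X r (n, A)" for A n x y
  proof -
    have "\<rho> x y \<le> C * neg_powr L (boundary_prod X (boundary_map X x) (boundary_map X y))"
      using A cluster_subset by (intro up) auto
    also have "\<dots> \<le> C * L powr (- (real n - 2 * real r - 1 / 2 - 2 * \<delta>))"
      using C L boundary_prod_ge_of_cluster[OF A] by (intro mult_left_mono neg_powr_le) auto
    also have "- (real n - 2 * real r - 1 / 2 - 2 * \<delta>) = (2 * real r + 1 / 2 + 2 * \<delta>) + - real n"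
      by simp
    also have "C * L powr \<dots> = E * q n"
      unfolding E_def q_def powr_add by simp
    finally show ?thesis .
  qed
  have ball: "y \<in> cluster X r (n, A)"
    if A: "A \<in> X n" "x \<in> A" and y: "y \<in> S" "\<rho> x y < 1 / C * q n" for A n x y
  proof (rule cluster_contains_large_boundary_prod[OF r A y(1)])
    have "x \<in> S" using A tile_subset[of "(n, A)"] by (auto simp: tiles_def)
    then have "1 / C * neg_powr L (boundary_prod X (boundary_map X x) (boundary_map X y)) < 1 / C * q n"
      using lo[of x y] y by simp
    then have "neg_powr L (boundary_prod X (boundary_map X x) (boundary_map X y)) < q n"
      using C by (simp add: field_simps)
    then show "boundary_prod X (boundary_map X x) (boundary_map X y) > ereal (real n)"
      using L by (intro less_of_neg_powr_less[OF L]) (auto simp: q_def)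
  qed
  have bd: "\<rho>.mbounded S"
    unfolding \<rho>.mbounded_alt
  proof (intro conjI exI ballI)
    fix x y assume "x \<in> S" "y \<in> S"
    moreover have "cluster X r (0, S) = S"
      using cluster_covers_0[of r] by (auto simp: cluster_covers_def root)
    ultimately show "\<rho> x y \<le> E * q 0" using E[of S 0 x y] by (simp add: root)
  qed simp
  \<comment> \<open>The annulus must lie in the ball of radius \<open>1 / C * q n\<close>, and its outer radius must not exceed
    the diameter of \<open>S\<close>.\<close>
  define D where "D = min (1 / C) (mdiam \<rho> S)"
  have "mdiam \<rho> S > 0" using two \<rho>.mdiam_pos[OF bd order_refl] by blast
  then have D: "D > 0" "D \<le> 1 / C" "D \<le> mdiam \<rho> S" using C by (auto simp: D_def)
  have low: "l * D * q n \<le> mdiam \<rho> (cluster X r (n, A))" if A: "A \<in> X n" for A n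
  proof -
    have a: "(n, A) \<in> tiles X" using A by (simp add: tiles_def)
    obtain x where x: "x \<in> A" using nonempty[OF A] by blast
    have xS: "x \<in> S" using tile_subset[OF a] x by auto
    have "D * q n \<le> D * 1" using D q[of n] by (intro mult_left_mono) auto
    then have "D * q n \<le> mdiam \<rho> S" using D(3) by linarith
    moreover have "0 < D * q n" using D q[of n] by simp
    ultimately obtain z where z: "z \<in> S" "l * (D * q n) \<le> \<rho> x z" "\<rho> x z < D * q n"
      using ann(2) xS unfolding has_annuli_def by blast
    have "D * q n \<le> 1 / C * q n" using D q[of n] by (intro mult_right_mono) auto
    then have "z \<in> cluster X r (n, A)" using z by (intro ball[OF A x]) auto
    moreover have "x \<in> cluster X r (n, A)" using tile_subset_cluster[OF a, of r] x by auto
    ultimately have "\<rho> x z \<le> mdiam \<rho> (cluster X r (n, A))"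
      by (intro \<rho>.le_mdiam[OF bd cluster_subset])
    then show ?thesis using z by simp
  qed
  have ne: "cluster X r (n, A) \<noteq> {}" if "A \<in> X n" for A n
    using nonempty[OF that] tile_subset_cluster[of "(n, A)" r] that by (auto simp: tiles_def)
  have sep: "1 / C * q n \<le> \<rho> x y"
    if V: "V \<in> cluster_covers X r n" "V' \<in> cluster_covers X r n"
      and dj: "tile_nbhd (cluster_covers X r n) 1 V \<inter> tile_nbhd (cluster_covers X r n) 1 V' = {}"
      and xy: "x \<in> V" "y \<in> V'" for V V' n x y
  proof (rule ccontr)
    assume less: "\<not> 1 / C * q n \<le> \<rho> x y"
    have S: "x \<in> S" "y \<in> S" using V xy cluster_subset by (auto simp: cluster_covers_def)
    obtain A where A: "A \<in> X n" "x \<in> A" using tile_containing[OF S(1)] .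
    obtain B where B: "B \<in> X n" "y \<in> B" using tile_containing[OF S(2)] .
    have mem: "x \<in> cluster X r (n, A)" "y \<in> cluster X r (n, B)"
      using tile_subset_cluster[of "(n, A)" r] tile_subset_cluster[of "(n, B)" r] A B
      by (auto simp: tiles_def)
    have cl: "cluster X r (n, A) \<in> cluster_covers X r n" "cluster X r (n, B) \<in> cluster_covers X r n"
      using A B by (auto simp: cluster_covers_def)
    have "cluster X r (n, A) \<subseteq> tile_nbhd (cluster_covers X r n) 1 V"
      using mem xy by (intro tile_nbhd_1_superset V cl) auto
    moreover have "cluster X r (n, B) \<subseteq> tile_nbhd (cluster_covers X r n) 1 V'"
      using mem xy by (intro tile_nbhd_1_superset V cl) auto
    moreover have "y \<in> cluster X r (n, A)" using less by (intro ball[OF A S(2)]) simp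
    ultimately show False using dj mem by blast
  qed
  define K where "K = max (max C E) (1 / (l * D))"
  have lD: "0 < l * D" using ann(1) D(1) by simp
  have K: "C \<le> K" "E \<le> K" "1 / (l * D) \<le> K" "1 \<le> K" using C by (auto simp: K_def)
  have K': "1 / K \<le> 1 / C" "1 / K \<le> l * D"
    using K C lD by (auto simp: field_simps)
  have diam: "1 / K * q n \<le> mdiam \<rho> V \<and> mdiam \<rho> V \<le> K * q n" if V: "V \<in> cluster_covers X r n" for V n
  proof -
    obtain A where A: "A \<in> X n" "V = cluster X r (n, A)" using V by (auto simp: cluster_covers_def)
    have "1 / K * q n \<le> l * D * q n" using K' q[of n] by (intro mult_right_mono) auto
    moreover have "mdiam \<rho> V \<le> E * q n" using ne[OF A(1)] E[OF A(1)] A(2) by (intro mdiam_le) auto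
    moreover have "E * q n \<le> K * q n" using K q[of n] by (intro mult_right_mono) auto
    ultimately show ?thesis using low[OF A(1)] A(2) by simp
  qed
  have dist: "1 / K * q n \<le> msetdist \<rho> V V'"
    if V: "V \<in> cluster_covers X r n" "V' \<in> cluster_covers X r n"
      and dj: "tile_nbhd (cluster_covers X r n) 1 V \<inter> tile_nbhd (cluster_covers X r n) 1 V' = {}" for V V' n
  proof (rule msetdist_ge)
    show "V \<noteq> {}" "V' \<noteq> {}" using V ne by (auto simp: cluster_covers_def)
    fix x y assume xy: "x \<in> V" "y \<in> V'"
    have "1 / K * q n \<le> 1 / C * q n" using K' q[of n] by (intro mult_right_mono) auto
    also have "\<dots> \<le> \<rho> x y" by (rule sep[OF V dj xy])
    finally show "1 / K * q n \<le> \<rho> x y" .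
  qed
  have "(\<forall>V\<in>cluster_covers X r n. 1 / K * q n \<le> mdiam \<rho> V \<and> mdiam \<rho> V \<le> K * q n) \<and>
        (\<forall>V\<in>cluster_covers X r n. \<forall>V'\<in>cluster_covers X r n.
           tile_nbhd (cluster_covers X r n) 1 V \<inter> tile_nbhd (cluster_covers X r n) 1 V' = {} \<longrightarrow>
           1 / K * q n \<le> msetdist \<rho> V V')" for n
    using diam dist by blast
  then show ?thesis
    unfolding visual_approximation_def
    using metric bd L cover_seq_cluster_covers cluster_covers_0 K(4) unfolding q_def by blast
qed

end

lemma Metric_space_pullback:
  assumes "Metric_space T \<rho>" "inj_on \<phi> S" "\<phi> ` S \<subseteq> T"
  shows "Metric_space S (\<lambda>x y. \<rho> (\<phi> x) (\<phi> y))"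
proof -
  interpret Metric_space T \<rho> by fact
  show ?thesis
  proof
    fix x y z
    show "0 \<le> \<rho> (\<phi> x) (\<phi> y)" "\<rho> (\<phi> x) (\<phi> y) = \<rho> (\<phi> y) (\<phi> x)" by (simp_all add: commute)
    show "\<rho> (\<phi> x) (\<phi> y) = 0 \<longleftrightarrow> x = y" if "x \<in> S" "y \<in> S"
    proof -
      have "\<phi> x \<in> T" "\<phi> y \<in> T" using that assms(3) by auto
      then show ?thesis using zero inj_on_eq_iff[OF assms(2) that] by simp
    qed
    show "\<rho> (\<phi> x) (\<phi> z) \<le> \<rho> (\<phi> x) (\<phi> y) + \<rho> (\<phi> y) (\<phi> z)" if "x \<in> S" "y \<in> S" "z \<in> S"
      using that assms(3) by (intro triangle) auto
  qed
qed

theorem theorem11p1: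
  fixes S :: "'a set" and d :: "'a \<Rightarrow> 'a \<Rightarrow> real"
    and X :: "nat \<Rightarrow> 'a set set"
    and d_inf :: "(nat \<Rightarrow> 'a tile) set \<Rightarrow> (nat \<Rightarrow> 'a tile) set \<Rightarrow> real"
  assumes "Metric_space S d"
    and "Metric_space.mbounded S d S"
    and "\<exists>x\<in>S. \<exists>y\<in>S. x \<noteq> y"
    and "Metric_space.mcomplete S d"
    and "uniformly_perfect S d"
    and "cover_seq S X"
    and "\<And>n A. A \<in> X n \<Longrightarrow> A \<noteq> {}"
    and "X 0 = {S}"
    and "gromov_hyperbolic X"
    and "visual_metric X d_inf"
  shows "\<exists>r0::nat. \<forall>r\<ge>r0.
           (quasisymmetry S d (boundary X) d_inf (boundary_map X) \<longrightarrow>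
              quasi_visual_approximation S d 1 (cluster_covers X r)) \<and>
           (snowflake_equivalence S d (boundary X) d_inf (boundary_map X) \<longrightarrow>
              (\<exists>\<Lambda>>1. visual_approximation S d 1 \<Lambda> (cluster_covers X r)))"
proof -
  obtain \<delta> where \<delta>: "\<delta> \<ge> 0" "\<And>u v z. u \<in> tiles X \<Longrightarrow> v \<in> tiles X \<Longrightarrow> z \<in> tiles X \<Longrightarrow>
      gromov_prod X u v \<ge> min (gromov_prod X u z) (gromov_prod X z v) - \<delta>"
    using assms(9) unfolding gromov_hyperbolic_def by blast
  interpret hyperbolic_tile_graph S X \<delta>
    by unfold_locales (use assms(6-8) \<delta> in auto)
  define \<rho> where "\<rho> = (\<lambda>x y. d_inf (boundary_map X x) (boundary_map X y))"
  obtain L C where LC: "L > 1" "C \<ge> 1"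
    and vis: "\<And>\<xi> \<zeta>. \<xi> \<in> boundary X \<Longrightarrow> \<zeta> \<in> boundary X \<Longrightarrow>
           1 / C * neg_powr L (boundary_prod X \<xi> \<zeta>) \<le> d_inf \<xi> \<zeta> \<and>
           d_inf \<xi> \<zeta> \<le> C * neg_powr L (boundary_prod X \<xi> \<zeta>)"
    and dm: "Metric_space (boundary X) d_inf"
    using assms(10) unfolding visual_metric_def by blast
  obtain l where l: "0 < l" "has_annuli S d l"
    using uniformly_perfect_has_annuli[OF assms(1,5)] .
  have metric: "Metric_space S \<rho>" if "bij_betw (boundary_map X) S (boundary X)"
    unfolding \<rho>_def using that by (intro Metric_space_pullback[OF dm]) (auto simp: bij_betw_def)
  have visual: "visual_approximation S \<rho> 1 L (cluster_covers X r)"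
    if bij: "bij_betw (boundary_map X) S (boundary X)" and qs: "qs_comparable S d \<rho>"
      and r: "1 + 8 * \<delta> \<le> real r" for r
  proof -
    obtain l' where l': "0 < l'" "has_annuli S \<rho> l'"
      using has_annuli_qs_comparable[OF assms(1) metric[OF bij] assms(2) l qs] .
    have "boundary_map X x \<in> boundary X" if "x \<in> S" for x
      using bij that by (auto simp: bij_betw_def)
    then show ?thesis
      using vis unfolding \<rho>_def
      by (intro visual_approximation_cluster_covers[OF r assms(3) _ l'(1) _ LC]
            metric[OF bij, unfolded \<rho>_def] l'(2)[unfolded \<rho>_def]) blast+
  qed
  have "quasi_visual_approximation S d 1 (cluster_covers X r)"
    if q: "quasisymmetry S d (boundary X) d_inf (boundary_map X)" and r: "1 + 8 * \<delta> \<le> real r" for r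
  proof -
    have bij: "bij_betw (boundary_map X) S (boundary X)" using q by (simp add: quasisymmetry_def)
    have qs: "qs_comparable S d \<rho>"
      unfolding \<rho>_def
      by (rule quasisymmetry_imp_qs_comparable[OF assms(1) metric[OF bij, unfolded \<rho>_def] q])
    show ?thesis
      by (rule visual_approximation_qs_comparable[OF visual[OF bij qs r] assms(1-3) qs])
  qed
  moreover have "\<exists>\<Lambda>>1. visual_approximation S d 1 \<Lambda> (cluster_covers X r)"
    if q: "snowflake_equivalence S d (boundary X) d_inf (boundary_map X)" and r: "1 + 8 * \<delta> \<le> real r" for r
  proof -
    have bij: "bij_betw (boundary_map X) S (boundary X)"
      using q by (simp add: snowflake_equivalence_def)
    obtain a B where a: "a > 0" "B \<ge> 1"
      and lo: "\<And>x y. x \<in> S \<Longrightarrow> y \<in> S \<Longrightarrow> 1 / B * d x y powr a \<le> \<rho> x y"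
      and up: "\<And>x y. x \<in> S \<Longrightarrow> y \<in> S \<Longrightarrow> \<rho> x y \<le> B * d x y powr a"
      using q unfolding snowflake_equivalence_def \<rho>_def by blast
    have qs: "qs_comparable S d \<rho>"
      by (rule snowflake_imp_qs_comparable[OF assms(1) a lo up])
    have "visual_approximation S d 1 (L powr (1 / a)) (cluster_covers X r)"
      by (rule visual_approximation_snowflake[OF visual[OF bij qs r] assms(1,2) a lo up])
    then show ?thesis using LC(1) a(1) by (intro exI[of _ "L powr (1 / a)"]) simp
  qed
  moreover have "1 + 8 * \<delta> \<le> real r" if "r \<ge> nat \<lceil>1 + 8 * \<delta>\<rceil>" for r
    using that by linarith
  ultimately show ?thesis by blast
qed

end
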